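(* Vertex Cover by CVD cannot be solved in ${\mathcal O}^*((2- \epsilon)^{k})$ time for any $\epsilon >0$ assuming the Strong Exponential Time Hypothesis (SETH).
   Context: Vertex Cover by CVD: given a graph $G$ and integers $k,\ell$, with parameter $k$ the size of a chordal vertex deletion set of $G$, decide whether $G$ has a vertex cover of size $\ell$. ${\mathcal O}^*$ hides factors polynomial in the input size. The lower bound holds even when a chordal vertex deletion set of size $k$ is given in the input. *)

theory Defs
  imports Complex_Main "HOL-Library.Log_Nat"
begin

section \<open>Random access machines with logarithmic cost\<close>

text \<open>
  Programs act on numbered registers and a memory with indirect addressing, both holding natural
  numbers. Every step is charged one plus the bit lengths of the numbers and addresses it
  handles. \<open>Sub\<close> is truncated subtraction; \<open>Cond\<close> and \<open>While\<close> branch on the register being nonzero.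
\<close>

type_synonym state = "(nat \<Rightarrow> nat) \<times> (nat \<Rightarrow> nat)"

datatype com =
    Imm nat nat
  | Add nat nat nat
  | Sub nat nat nat
  | Load nat nat
  | Store nat nat
  | Seq com com
  | Cond nat com com
  | While nat com

abbreviation bits :: "nat \<Rightarrow> nat" where
  "bits n \<equiv> floorlog 2 n"

inductive exec :: "com \<Rightarrow> state \<Rightarrow> nat \<Rightarrow> state \<Rightarrow> bool" where
  Imm: "exec (Imm r n) (R, M) (1 + bits n) (R(r := n), M)"
| Add: "exec (Add r a b) (R, M) (1 + bits (R a) + bits (R b)) (R(r := R a + R b), M)"
| Sub: "exec (Sub r a b) (R, M) (1 + bits (R a) + bits (R b)) (R(r := R a - R b), M)"
| Load: "exec (Load r a) (R, M) (1 + bits (R a) + bits (M (R a))) (R(r := M (R a)), M)"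
| Store: "exec (Store a r) (R, M) (1 + bits (R a) + bits (R r)) (R, M(R a := R r))"
| Seq: "exec c1 s t1 s' \<Longrightarrow> exec c2 s' t2 s'' \<Longrightarrow> exec (Seq c1 c2) s (t1 + t2) s''"
| Cond_True: "R r \<noteq> 0 \<Longrightarrow> exec c1 (R, M) t s' \<Longrightarrow>
    exec (Cond r c1 c2) (R, M) (1 + bits (R r) + t) s'"
| Cond_False: "R r = 0 \<Longrightarrow> exec c2 (R, M) t s' \<Longrightarrow>
    exec (Cond r c1 c2) (R, M) (1 + bits (R r) + t) s'"
| While_True: "R r \<noteq> 0 \<Longrightarrow> exec c (R, M) t1 s' \<Longrightarrow> exec (While r c) s' t2 s'' \<Longrightarrow>
    exec (While r c) (R, M) (1 + bits (R r) + t1 + t2) s''"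
| While_False: "R r = 0 \<Longrightarrow> exec (While r c) (R, M) (1 + bits (R r)) (R, M)"

inductive_cases exec_ImmE: "exec (Imm r n) s t s'"
inductive_cases exec_AddE: "exec (Add r a b) s t s'"
inductive_cases exec_SubE: "exec (Sub r a b) s t s'"
inductive_cases exec_LoadE: "exec (Load r a) s t s'"
inductive_cases exec_StoreE: "exec (Store a r) s t s'"
inductive_cases exec_SeqE: "exec (Seq c1 c2) s t s'"
inductive_cases exec_CondE: "exec (Cond r c1 c2) s t s'"
inductive_cases exec_WhileE: "exec (While r c) s t s'"

lemma exec_deterministic:
  "exec c s t s' \<Longrightarrow> exec c s u s'' \<Longrightarrow> u = t \<and> s'' = s'"
proof (induction arbitrary: u s'' rule: exec.induct)
  case (Seq c1 s t1 s' c2 t2 s2)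
  from Seq.prems obtain a m b where ab: "u = a + b" "exec c1 s a m" "exec c2 m b s''"
    by (rule exec_SeqE) simp
  with Seq.IH(1)[OF ab(2)] Seq.IH(2)[of b s''] show ?case by simp
next
  case (Cond_True R r c1 M t s' c2)
  from Cond_True.prems Cond_True.hyps obtain a where
    a: "u = 1 + bits (R r) + a" "exec c1 (R, M) a s''"
    by (elim exec_CondE) simp_all
  with Cond_True.IH[OF a(2)] show ?case by simp
next
  case (Cond_False R r c2 M t s' c1)
  from Cond_False.prems Cond_False.hyps obtain a where
    a: "u = 1 + bits (R r) + a" "exec c2 (R, M) a s''"
    by (elim exec_CondE) simp_all
  with Cond_False.IH[OF a(2)] show ?case by simp
next
  case (While_True R r c M t1 s' t2 s2)
  from While_True.prems obtain a m b where
    ab: "u = 1 + bits (R r) + a + b" "exec c (R, M) a m" "exec (While r c) m b s''"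
    by (rule exec_WhileE) (use While_True.hyps in simp_all)
  with While_True.IH(1)[OF ab(2)] While_True.IH(2)[of b s''] show ?case by simp
next
  case (While_False R r c M)
  from While_False.prems show ?case by (rule exec_WhileE) (use While_False.hyps in simp_all)
next
  case (Imm r n R M) then show ?case by (elim exec_ImmE) simp
next
  case (Add r a R b M) then show ?case by (elim exec_AddE) simp
next
  case (Sub r a R b M) then show ?case by (elim exec_SubE) simp
next
  case (Load r a R M) then show ?case by (elim exec_LoadE) simp
next
  case (Store a r R M) then show ?case by (elim exec_StoreE) simp
qed

text \<open>
  The input word occupies the initial memory cells, register 0 holds its length, and everything
  else is 0. A halting program accepts iff it leaves a nonzero value in register 0.
\<close>

definition init :: "nat list \<Rightarrow> state" where
  "init xs = ((\<lambda>r. if r = 0 then length xs else 0), (\<lambda>i. if i < length xs then xs ! i else 0))"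

definition accepting :: "state \<Rightarrow> bool" where
  "accepting s \<longleftrightarrow> fst s 0 \<noteq> 0"

definition input_size :: "nat list \<Rightarrow> nat" where
  "input_size xs = (\<Sum>x\<leftarrow>xs. 1 + bits x)"


section \<open>Parameterized problems\<close>

text \<open>
  Problems are promise problems: nothing is required of a program on words that do not
  encode a member of \<open>instances\<close>.
\<close>

record 'i param_problem =
  instances :: "'i set"
  encode :: "'i \<Rightarrow> nat list"
  param :: "'i \<Rightarrow> nat"
  yes_instance :: "'i \<Rightarrow> bool"

text \<open>Solvable in time \<open>f(k) \<cdot> |x|\<^sup>O\<^sup>(\<^sup>1\<^sup>)\<close>, that is \<open>O\<^sup>*(f(k))\<close>, where \<open>k\<close> is the parameter.\<close>

definition solvable_Ostar :: "'i param_problem \<Rightarrow> (nat \<Rightarrow> real) \<Rightarrow> bool" where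
  "solvable_Ostar \<Pi> f \<longleftrightarrow>
    (\<exists>P (C::real) (c::nat). C > 0 \<and> (\<forall>x \<in> instances \<Pi>. \<exists>t s.
        exec P (init (encode \<Pi> x)) t s \<and>
        (accepting s \<longleftrightarrow> yes_instance \<Pi> x) \<and>
        real t \<le> C * f (param \<Pi> x) * real (input_size (encode \<Pi> x)) ^ c))"


section \<open>Satisfiability and SETH\<close>

text \<open>The literal \<open>(v, True)\<close> is the variable \<open>v\<close>, and \<open>(v, False)\<close> its negation.\<close>

type_synonym literal = "nat \<times> bool"
type_synonym cnf = "literal list list"

definition satisfiable :: "cnf \<Rightarrow> bool" where
  "satisfiable F \<longleftrightarrow> (\<exists>\<alpha> :: nat \<Rightarrow> bool. \<forall>c \<in> set F. \<exists>(v, b) \<in> set c. \<alpha> v = b)"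

definition is_qcnf :: "nat \<Rightarrow> nat \<Rightarrow> cnf \<Rightarrow> bool" where
  "is_qcnf q n F \<longleftrightarrow> (\<forall>c \<in> set F. length c \<le> q \<and> (\<forall>(v, b) \<in> set c. v < n))"

fun encode_literal :: "literal \<Rightarrow> nat" where
  "encode_literal (v, b) = 2 * v + of_bool b"

definition encode_cnf :: "nat \<Rightarrow> cnf \<Rightarrow> nat list" where
  "encode_cnf n F = n # length F # concat (map (\<lambda>c. length c # map encode_literal c) F)"

definition SAT :: "nat \<Rightarrow> (nat \<times> cnf) param_problem" where
  "SAT q = \<lparr> instances = {(n, F). is_qcnf q n F},
             encode = (\<lambda>(n, F). encode_cnf n F),
             param = (\<lambda>(n, F). n),
             yes_instance = (\<lambda>(n, F). satisfiable F) \<rparr>"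

definition SETH :: bool where
  "SETH \<longleftrightarrow> (\<forall>\<delta>::real. \<delta> < 1 \<longrightarrow>
     (\<exists>q. \<not> solvable_Ostar (SAT q) (\<lambda>n. 2 powr (\<delta> * real n))))"


section \<open>Chordal vertex deletion sets and vertex covers\<close>

definition simple_graph :: "'a set \<Rightarrow> 'a set set \<Rightarrow> bool" where
  "simple_graph V E \<longleftrightarrow> finite V \<and> (\<forall>e \<in> E. e \<subseteq> V \<and> card e = 2)"

definition vertex_cover :: "'a set \<Rightarrow> 'a set set \<Rightarrow> 'a set \<Rightarrow> bool" where
  "vertex_cover V E X \<longleftrightarrow> X \<subseteq> V \<and> (\<forall>e \<in> E. e \<inter> X \<noteq> {})"

definition is_cycle :: "'a set \<Rightarrow> 'a set set \<Rightarrow> 'a list \<Rightarrow> bool" where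
  "is_cycle V E vs \<longleftrightarrow> length vs \<ge> 3 \<and> distinct vs \<and> set vs \<subseteq> V \<and>
     (\<forall>i < length vs. {vs ! i, vs ! (Suc i mod length vs)} \<in> E)"

definition has_chord :: "'a set set \<Rightarrow> 'a list \<Rightarrow> bool" where
  "has_chord E vs \<longleftrightarrow> (\<exists>i < length vs. \<exists>j < length vs.
     i \<noteq> j \<and> j \<noteq> Suc i mod length vs \<and> i \<noteq> Suc j mod length vs \<and> {vs ! i, vs ! j} \<in> E)"

definition chordal :: "'a set \<Rightarrow> 'a set set \<Rightarrow> bool" where
  "chordal V E \<longleftrightarrow> (\<forall>vs. is_cycle V E vs \<and> length vs \<ge> 4 \<longrightarrow> has_chord E vs)"

definition chordal_deletion_set :: "'a set \<Rightarrow> 'a set set \<Rightarrow> 'a set \<Rightarrow> bool" where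
  "chordal_deletion_set V E S \<longleftrightarrow> S \<subseteq> V \<and> chordal (V - S) {e \<in> E. e \<inter> S = {}}"

text \<open>Machine inputs are graphs on \<open>{0..<n}\<close>, given by their adjacency matrix.\<close>

definition adjacency_bits :: "nat \<Rightarrow> nat set set \<Rightarrow> nat list" where
  "adjacency_bits n E = concat (map (\<lambda>u. map (\<lambda>v. of_bool ({u, v} \<in> E)) [0..<n]) [0..<n])"

definition membership_bits :: "nat \<Rightarrow> nat set \<Rightarrow> nat list" where
  "membership_bits n S = map (\<lambda>v. of_bool (v \<in> S)) [0..<n]"

text \<open>Instances are \<open>(n, E, k, l)\<close>, with the promise that a chordal deletion set of size \<open>k\<close> exists.\<close>

definition VC_by_CVD :: "(nat \<times> nat set set \<times> nat \<times> nat) param_problem" where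
  "VC_by_CVD = \<lparr>
     instances = {(n, E, k, l). simple_graph {0..<n} E \<and>
                    (\<exists>S. chordal_deletion_set {0..<n} E S \<and> card S = k)},
     encode = (\<lambda>(n, E, k, l). n # k # l # adjacency_bits n E),
     param = (\<lambda>(n, E, k, l). k),
     yes_instance = (\<lambda>(n, E, k, l). \<exists>X. vertex_cover {0..<n} E X \<and> card X = l) \<rparr>"

text \<open>The variant in which a chordal deletion set \<open>S\<close> of size \<open>k\<close> is part of the input.\<close>

definition VC_by_given_CVD :: "(nat \<times> nat set set \<times> nat set \<times> nat \<times> nat) param_problem" where
  "VC_by_given_CVD = \<lparr>
     instances = {(n, E, S, k, l). simple_graph {0..<n} E \<and>
                    chordal_deletion_set {0..<n} E S \<and> card S = k},
     encode = (\<lambda>(n, E, S, k, l). n # k # l # adjacency_bits n E @ membership_bits n S),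
     param = (\<lambda>(n, E, S, k, l). k),
     yes_instance = (\<lambda>(n, E, S, k, l). \<exists>X. vertex_cover {0..<n} E X \<and> card X = l) \<rparr>"

end

theory Submission
  imports Defs "HOL-Library.FuncSet"
begin

text \<open>
  Split the \<open>n\<close> variables of a \<open>q\<close>-CNF formula into groups of \<open>p = 2 ^ J - J\<close> and represent a group by a block of
  \<open>2 ^ J\<close> elements. As the central binomial coefficient of \<open>2 ^ J\<close> is at least \<open>2 ^ p\<close>, every assignment of
  the group is encoded by a half-size subset of the block. A set of at most half of all elements that hits every
  subset of a block larger than half of it meets each block in exactly half, and a constant number of further sets
  per clause rules out the falsifying choices. Hitting sets become vertex covers by adding for each set a clique
  with one vertex per element, attached to that element: all clique vertices but one are in the cover, and the
  missing one names an element that hits the set. Removing the elements leaves disjoint cliques, so the elements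
  form a chordal deletion set, of size \<open>2 ^ J * (n div p + 1)\<close>. Since \<open>2 ^ J / p\<close> tends to 1, an algorithm with base
  below 2 would give one for \<open>q\<close>-SAT, with base below 2 independent of \<open>q\<close>. The number \<open>n\<close> may be exponential in the
  input size, but polynomial factors in \<open>n\<close> are absorbed by the exponential.
\<close>

section \<open>Weakest preconditions for timed executions\<close>

text \<open>SETH supplies \<open>q\<close> only after the rate \<open>\<delta>\<close> is fixed, so
  the block size must be chosen from the base alone. Hence \<open>q\<close> enters only through the
  constant \<open>Z\<close>, which multiplies the number of sets but leaves the number of elements,
  the parameter, unchanged. Coding each variable by its own pair of elements would be simpler, but
  doubles the parameter and excludes only bases below \<open>sqrt 2\<close>; half-size subsets lose
  only \<open>J\<close> variables per \<open>2 ^ J\<close> elements.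

  The size bound acts as a consistency check: at least \<open>h\<close> elements in every block and
  a total of \<open>h\<close> per block leave no slack, and sets of equal size cannot be properly
  nested, so missing a clause set means agreeing with a tuple on every block that the clause
  touches.

  The machine model is concrete, so the reduction must itself be a timed program. Composing
  list-processing programs is avoided by describing the output cell by cell, as a length and an
  entry for each position. Both lie in a class of functions closed under arithmetic, bounded sums
  and finite tables, and one generic program turns such a pair into a reduction.\<close>

definition wp :: "com \<Rightarrow> state \<Rightarrow> (nat \<Rightarrow> state \<Rightarrow> bool) \<Rightarrow> bool" where
  "wp P s Q \<longleftrightarrow> (\<exists>t s'. exec P s t s' \<and> Q t s')"

text \<open>Determinism turns the existential quantifiers of \<open>wp\<close> into evaluation, so
  the rules for single instructions become rewriting equations.\<close>

lemma wp_exec: "exec P s t s' \<Longrightarrow> wp P s Q \<longleftrightarrow> Q t s'"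
  unfolding wp_def using exec_deterministic by blast

lemma wp_Imm: "wp (Imm r n) (R, M) Q \<longleftrightarrow> Q (1 + bits n) (R(r := n), M)"
  by (rule wp_exec[OF exec.Imm])

lemma wp_Add: "wp (Add r a b) (R, M) Q \<longleftrightarrow> Q (1 + bits (R a) + bits (R b)) (R(r := R a + R b), M)"
  by (rule wp_exec[OF exec.Add])

lemma wp_Sub: "wp (Sub r a b) (R, M) Q \<longleftrightarrow> Q (1 + bits (R a) + bits (R b)) (R(r := R a - R b), M)"
  by (rule wp_exec[OF exec.Sub])

lemma wp_Load: "wp (Load r a) (R, M) Q \<longleftrightarrow> Q (1 + bits (R a) + bits (M (R a))) (R(r := M (R a)), M)"
  by (rule wp_exec[OF exec.Load])

lemma wp_Store: "wp (Store a r) (R, M) Q \<longleftrightarrow> Q (1 + bits (R a) + bits (R r)) (R, M(R a := R r))"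
  by (rule wp_exec[OF exec.Store])

lemma wp_Seq: "wp (Seq P1 P2) s Q \<longleftrightarrow> wp P1 s (\<lambda>t1 s1. wp P2 s1 (\<lambda>t2 s2. Q (t1 + t2) s2))"
  unfolding wp_def by (blast elim: exec_SeqE intro: exec.Seq)

lemma wp_Cond: "wp (Cond r P1 P2) (R, M) Q \<longleftrightarrow>
    wp (if R r \<noteq> 0 then P1 else P2) (R, M) (\<lambda>t s. Q (1 + bits (R r) + t) s)"
proof (cases "R r = 0")
  case True
  have "exec (Cond r P1 P2) (R, M) (1 + bits (R r) + t) s" if "exec P2 (R, M) t s" for t s
    using True that by (rule exec.Cond_False)
  moreover have "\<exists>u. t = 1 + bits (R r) + u \<and> exec P2 (R, M) u s" if "exec (Cond r P1 P2) (R, M) t s" for t s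
    using that True by (auto elim: exec_CondE)
  ultimately have "exec (Cond r P1 P2) (R, M) t s \<longleftrightarrow> (\<exists>u. t = 1 + bits (R r) + u \<and> exec P2 (R, M) u s)" for t s
    by blast
  with True show ?thesis unfolding wp_def by auto
next
  case False
  have "exec (Cond r P1 P2) (R, M) (1 + bits (R r) + t) s" if "exec P1 (R, M) t s" for t s
    using False that by (rule exec.Cond_True)
  moreover have "\<exists>u. t = 1 + bits (R r) + u \<and> exec P1 (R, M) u s" if "exec (Cond r P1 P2) (R, M) t s" for t s
    using that False by (auto elim: exec_CondE)
  ultimately have "exec (Cond r P1 P2) (R, M) t s \<longleftrightarrow> (\<exists>u. t = 1 + bits (R r) + u \<and> exec P1 (R, M) u s)" for t s
    by blast
  with False show ?thesis unfolding wp_def by auto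
qed

lemma bits_0: "bits 0 = 0"
  by (simp add: floorlog_def)

lemmas wp_basic = wp_Imm wp_Add wp_Sub wp_Load wp_Store wp_Seq bits_0

lemma wp_mono: "wp P s Q \<Longrightarrow> (\<And>t s'. Q t s' \<Longrightarrow> Q' t s') \<Longrightarrow> wp P s Q'"
  unfolding wp_def by blast

lemma bits_le: "bits n \<le> n"
  by (rule floorlog_leI) auto

text \<open>\<open>Inv i\<close> describes the state after \<open>i\<close> rounds. The induction
  counts the rounds still to come; each round and the final test are charged
  \<open>n + 1 + T\<close>, the bit length of the counter being bounded by the counter itself. This
  is crude, but only polynomial growth matters.\<close>

lemma wp_While:
  assumes count: "\<And>i s. i \<le> n \<Longrightarrow> Inv i s \<Longrightarrow> fst s r = n - i"
    and step: "\<And>i s. i < n \<Longrightarrow> Inv i s \<Longrightarrow> wp B s (\<lambda>t s'. t \<le> T \<and> Inv (Suc i) s')"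
    and start: "Inv 0 s"
  shows "wp (While r B) s (\<lambda>t s'. t \<le> (n + 1) * (n + 1 + T) \<and> Inv n s')"
proof -
  have "i \<le> n \<Longrightarrow> Inv (n - i) s \<Longrightarrow> wp (While r B) s (\<lambda>t s'. t \<le> (i + 1) * (n + 1 + T) \<and> Inv n s')" for i s
  proof (induction i arbitrary: s)
    case 0
    obtain R M where s: "s = (R, M)" by (cases s)
    have "R r = 0" using count[of n s] 0 s by simp
    with 0 s show ?case by (simp add: wp_exec[OF exec.While_False] bits_0)
  next
    case (Suc i)
    obtain R M where s: "s = (R, M)" by (cases s)
    have R: "R r = Suc i" using count[of "n - Suc i" s] Suc.prems s by simp
    from step[of "n - Suc i" s] Suc.prems obtain t1 s1
      where 1: "exec B s t1 s1" "t1 \<le> T" "Inv (n - i) s1"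
      unfolding wp_def by (auto simp: Suc_diff_Suc)
    from Suc.IH[of s1] 1 Suc.prems obtain t2 s2
      where 2: "exec (While r B) s1 t2 s2" "t2 \<le> (i + 1) * (n + 1 + T)" "Inv n s2"
      unfolding wp_def by auto
    have "exec (While r B) s (1 + bits (R r) + t1 + t2) s2"
      using exec.While_True[of R r B M t1 s1 t2 s2] 1 2 R s by simp
    moreover have "1 + bits (R r) + t1 + t2 \<le> (Suc i + 1) * (n + 1 + T)"
      using 1 2 R bits_le[of "R r"] Suc.prems by simp
    ultimately show ?case using 2 unfolding wp_def by blast
  qed
  from this[of n s] start show ?thesis by simp
qed

section \<open>Polynomial growth of bounds\<close>

definition poly_growth :: "(nat \<Rightarrow> nat) \<Rightarrow> bool" where
  "poly_growth T \<longleftrightarrow> (\<exists>K. \<forall>V. T V \<le> (V + 2) ^ K)"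

text \<open>The base \<open>V + 2\<close> is at least 2, so the exponent alone absorbs constants and
  no separate coefficient is needed.\<close>

lemma poly_growth_const: "poly_growth (\<lambda>_. c)"
proof -
  have "c \<le> (V + 2) ^ c" for V :: nat
    using less_exp[of c] power_mono[of 2 "V + 2" c] by simp
  then show ?thesis unfolding poly_growth_def by blast
qed

lemma poly_growth_id: "poly_growth (\<lambda>V. V)"
  unfolding poly_growth_def by (rule exI[of _ 1]) simp

lemma poly_growth_mult:
  assumes "poly_growth S" "poly_growth T" shows "poly_growth (\<lambda>V. S V * T V)"
proof -
  from assms obtain K K' where "\<forall>V. S V \<le> (V + 2) ^ K" "\<forall>V. T V \<le> (V + 2) ^ K'"
    unfolding poly_growth_def by blast
  then have "S V * T V \<le> (V + 2) ^ (K + K')" for V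
    by (simp add: power_add mult_le_mono)
  then show ?thesis unfolding poly_growth_def by blast
qed

lemma poly_growth_add:
  assumes "poly_growth S" "poly_growth T" shows "poly_growth (\<lambda>V. S V + T V)"
proof -
  from assms obtain K K' where K: "\<forall>V. S V \<le> (V + 2) ^ K" "\<forall>V. T V \<le> (V + 2) ^ K'"
    unfolding poly_growth_def by blast
  have "S V + T V \<le> (V + 2) ^ (K + K' + 1)" for V
  proof -
    have "S V \<le> (V + 2) ^ (K + K')" "T V \<le> (V + 2) ^ (K + K')"
      using K power_increasing[of K "K + K'" "V + 2"] power_increasing[of K' "K + K'" "V + 2"]
      by (meson le_add1 le_add2 le_trans one_le_numeral trans_le_add2)+
    then have "S V + T V \<le> 2 * (V + 2) ^ (K + K')" by simp
    also have "\<dots> \<le> (V + 2) * (V + 2) ^ (K + K')" by (rule mult_le_mono1) simp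
    finally show ?thesis by simp
  qed
  then show ?thesis unfolding poly_growth_def by blast
qed

lemma poly_growth_compose:
  assumes "poly_growth S" "poly_growth T" shows "poly_growth (\<lambda>V. S (T V))"
proof -
  from assms(1) obtain K where K: "\<forall>V. S V \<le> (V + 2) ^ K"
    unfolding poly_growth_def by blast
  from poly_growth_add[OF assms(2) poly_growth_const[of 2]] obtain K'
    where K': "\<forall>V. T V + 2 \<le> (V + 2) ^ K'"
    unfolding poly_growth_def by blast
  have "S (T V) \<le> (V + 2) ^ (K' * K)" for V
    using K K' power_mono[of "T V + 2" "(V + 2) ^ K'" K]
    by (metis le_trans power_mult zero_le)
  then show ?thesis unfolding poly_growth_def by blast
qed

lemmas poly_growth_intros =
  poly_growth_const poly_growth_id poly_growth_add poly_growth_mult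

section \<open>Polynomial-time functions of the input word\<close>

definition fits :: "nat list \<Rightarrow> nat \<Rightarrow> bool" where
  "fits xs V \<longleftrightarrow> length xs \<le> V \<and> (\<forall>x \<in> set xs. x \<le> V)"

text \<open>\<open>V\<close> is any upper bound, not the maximum. Enlarging it brings several
  quantities under one bound; the time bounds themselves are not assumed to be monotone.\<close>

lemma fits_mono: "fits xs V \<Longrightarrow> V \<le> V' \<Longrightarrow> fits xs V'"
  unfolding fits_def by (meson le_trans)

text \<open>Values are bounded along with running times: a computed value may become a loop count or
  an operand, whose bit length is charged, so time bounds alone would not compose.\<close>

definition poly_bounded :: "('a \<Rightarrow> nat list) \<Rightarrow> ('a \<Rightarrow> nat) set \<Rightarrow> ('a \<Rightarrow> nat) \<Rightarrow> bool" where
  "poly_bounded I G f \<longleftrightarrow> (\<exists>T. poly_growth T \<and>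
     (\<forall>a V. fits (I a) V \<longrightarrow> (\<forall>g \<in> G. g a \<le> V) \<longrightarrow> f a \<le> T V))"

text \<open>
  In \<open>ready I L a V s\<close>, the abstract argument \<open>a\<close> determines the input word \<open>I a\<close>, and a pair
  \<open>(x, g) \<in> L\<close> says that register \<open>x\<close> holds \<open>g a\<close>. A program that \<open>computes\<close> \<open>f\<close> leaves
  \<open>f a\<close> in register \<open>d\<close> and uses only the registers from \<open>d\<close> up to \<open>D - 1\<close> as scratch space. Since only
  the cells below \<open>length (I a)\<close> are constrained, it also runs while output is being written behind the input.
\<close>

definition ready :: "('a \<Rightarrow> nat list) \<Rightarrow> (nat \<times> ('a \<Rightarrow> nat)) set \<Rightarrow> 'a \<Rightarrow> nat \<Rightarrow> state \<Rightarrow> bool" where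
  "ready I L a V s \<longleftrightarrow> fst s 0 = length (I a) \<and> (\<forall>j < length (I a). snd s j = I a ! j) \<and>
     fits (I a) V \<and> (\<forall>x g. (x, g) \<in> L \<longrightarrow> fst s x = g a \<and> g a \<le> V)"

definition computes :: "com \<Rightarrow> nat \<Rightarrow> (nat \<Rightarrow> nat) \<Rightarrow> ('a \<Rightarrow> nat list) \<Rightarrow>
    (nat \<times> ('a \<Rightarrow> nat)) set \<Rightarrow> nat \<Rightarrow> ('a \<Rightarrow> nat) \<Rightarrow> bool" where
  "computes P D T I L d f \<longleftrightarrow> (\<forall>a R M V. ready I L a V (R, M) \<longrightarrow>
     wp P (R, M) (\<lambda>t s. t \<le> T V \<and> (\<exists>R'. s = (R', M) \<and> R' d = f a \<and>
        (\<forall>x. x < d \<or> D \<le> x \<longrightarrow> R' x = R x))))"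

text \<open>\<open>0 < d\<close> protects register 0, which holds the input length and is consulted
  by every read of the input.\<close>

definition layout :: "('a \<Rightarrow> nat) set \<Rightarrow> (nat \<times> ('a \<Rightarrow> nat)) set \<Rightarrow> nat \<Rightarrow> bool" where
  "layout G L d \<longleftrightarrow> 0 < d \<and> (\<forall>x g. (x, g) \<in> L \<longrightarrow> x < d) \<and> G \<subseteq> snd ` L"

text \<open>
  Quantifying over all layouts makes \<open>polytime\<close> stable under composition: \<open>polytime I G f\<close> means that \<open>f\<close> is
  computable in time polynomial in the input length, the largest input entry and the values in \<open>G\<close>.
\<close>

definition polytime :: "('a \<Rightarrow> nat list) \<Rightarrow> ('a \<Rightarrow> nat) set \<Rightarrow> ('a \<Rightarrow> nat) \<Rightarrow> bool" where
  "polytime I G f \<longleftrightarrow> poly_bounded I G f \<and>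
     (\<forall>L d. layout G L d \<longrightarrow> (\<exists>P D T. poly_growth T \<and> computes P D T I L d f))"

lemma layout_Suc: "layout G L d \<Longrightarrow> layout G L (d + 1)"
  unfolding layout_def by (auto simp: less_Suc_eq)

lemma ready_cong:
  "ready I L a V (R, M) \<Longrightarrow> layout G L d \<Longrightarrow> (\<And>x. x < d \<Longrightarrow> R' x = R x) \<Longrightarrow> ready I L a V (R', M)"
  unfolding ready_def layout_def by auto

lemma ready_bound: "ready I L a V s \<Longrightarrow> layout G L d \<Longrightarrow> \<forall>g \<in> G. g a \<le> V"
  unfolding ready_def layout_def by force

lemma ready_fits: "ready I L a V s \<Longrightarrow> fits (I a) V"
  unfolding ready_def by blast

lemma polytimeI:
  assumes "poly_bounded I G f"
    and "\<And>L d. layout G L d \<Longrightarrow> \<exists>P D T. poly_growth T \<and> computes P D T I L d f"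
  shows "polytime I G f"
  using assms unfolding polytime_def by blast

lemma polytime_bounded:
  "polytime I G f \<Longrightarrow> \<exists>T. poly_growth T \<and> (\<forall>a V. fits (I a) V \<longrightarrow> (\<forall>g \<in> G. g a \<le> V) \<longrightarrow> f a \<le> T V)"
  unfolding polytime_def poly_bounded_def by blast

lemma polytime_program:
  assumes "polytime I G f" "layout G L d"
  shows "\<exists>P D T. poly_growth T \<and> computes P D T I L d f"
  using assms unfolding polytime_def by blast

lemma poly_boundedI:
  assumes "poly_growth T" "\<And>a V. fits (I a) V \<Longrightarrow> \<forall>g \<in> G. g a \<le> V \<Longrightarrow> f a \<le> T V"
  shows "poly_bounded I G f"
  using assms unfolding poly_bounded_def by blast

lemma computesI:
  assumes "\<And>a R M V. ready I L a V (R, M) \<Longrightarrow>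
     wp P (R, M) (\<lambda>t s. t \<le> T V \<and> (\<exists>R'. s = (R', M) \<and> R' d = f a \<and>
        (\<forall>x. x < d \<or> D \<le> x \<longrightarrow> R' x = R x)))"
  shows "computes P D T I L d f"
  using assms unfolding computes_def by blast

lemma wp_computes:
  assumes "computes P D T I L d f" "ready I L a V (R, M)"
    "\<And>t R'. t \<le> T V \<Longrightarrow> R' d = f a \<Longrightarrow> (\<And>x. x < d \<or> D \<le> x \<Longrightarrow> R' x = R x) \<Longrightarrow> Q t (R', M)"
  shows "wp P (R, M) Q"
proof -
  have "wp P (R, M) (\<lambda>t s. t \<le> T V \<and> (\<exists>R'. s = (R', M) \<and> R' d = f a \<and>
        (\<forall>x. x < d \<or> D \<le> x \<longrightarrow> R' x = R x)))"
    using assms(1,2) unfolding computes_def by blast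
  then show ?thesis by (rule wp_mono) (use assms(3) in blast)
qed

section \<open>Closure under the machine operations\<close>

lemma polytime_const: "polytime I G (\<lambda>_. c)"
proof (rule polytimeI)
  show "poly_bounded I G (\<lambda>_. c)"
    by (rule poly_boundedI[of "\<lambda>_. c"]) (auto intro: poly_growth_intros)
next
  fix L :: "(nat \<times> ('a \<Rightarrow> nat)) set" and d :: nat
  have "computes (Imm d c) (d + 1) (\<lambda>_. 1 + c) I L d (\<lambda>_. c)"
    by (rule computesI) (use bits_le[of c] in \<open>simp add: wp_basic\<close>)
  moreover have "poly_growth (\<lambda>_. 1 + c)" by (rule poly_growth_intros)
  ultimately show "\<exists>P D T. poly_growth T \<and> computes P D T I L d (\<lambda>_. c)" by blast
qed

lemma computes_copy:
  assumes "\<And>a V R M. ready I L a V (R, M) \<Longrightarrow> R x = f a \<and> f a \<le> V" "x < d"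
  shows "computes (Seq (Imm d 0) (Add d d x)) (d + 1) (\<lambda>V. 2 + V) I L d f"
proof (rule computesI)
  fix a R M V assume "ready I L a V (R, M)"
  then have "R x = f a" "f a \<le> V" using assms(1) by blast+
  then show "wp (Seq (Imm d 0) (Add d d x)) (R, M) (\<lambda>t s. t \<le> 2 + V \<and> (\<exists>R'. s = (R', M) \<and> R' d = f a \<and>
        (\<forall>x. x < d \<or> d + 1 \<le> x \<longrightarrow> R' x = R x)))"
    using assms(2) bits_le[of "f a"] by (simp add: wp_basic)
qed

lemma polytime_var:
  assumes "g \<in> G" shows "polytime I G g"
proof (rule polytimeI)
  show "poly_bounded I G g"
    by (rule poly_boundedI[of "\<lambda>V. V"]) (use assms in \<open>auto intro: poly_growth_intros\<close>)
next
  fix L :: "(nat \<times> ('a \<Rightarrow> nat)) set" and d :: nat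
  assume "layout G L d"
  then obtain x where x: "(x, g) \<in> L" "x < d" using assms unfolding layout_def by force
  then have "computes (Seq (Imm d 0) (Add d d x)) (d + 1) (\<lambda>V. 2 + V) I L d g"
    by (intro computes_copy) (auto simp: ready_def)
  moreover have "poly_growth (\<lambda>V. 2 + V)" by (intro poly_growth_intros)
  ultimately show "\<exists>P D T. poly_growth T \<and> computes P D T I L d g" by blast
qed

text \<open>One argument for addition and truncated subtraction: \<open>h x y \<le> x + y\<close> is
  the common property that keeps values polynomial. The second operand is computed from register
  \<open>d + 1\<close> on, so the first one survives in \<open>d\<close>.\<close>

lemma polytime_binary:
  assumes f: "polytime I G f" and g: "polytime I G g"
    and bound: "\<And>x y. h x y \<le> x + y"
    and C: "\<And>d R M. wp (C d) (R, M) (\<lambda>t s. t \<le> 1 + R d + R (d + 1) \<and> s = (R(d := h (R d) (R (d + 1))), M))"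
  shows "polytime I G (\<lambda>a. h (f a) (g a))"
proof -
  obtain Bf where Bf: "poly_growth Bf"
    "\<And>a V. fits (I a) V \<Longrightarrow> \<forall>g \<in> G. g a \<le> V \<Longrightarrow> f a \<le> Bf V"
    using polytime_bounded[OF f] by blast
  obtain Bg where Bg: "poly_growth Bg"
    "\<And>a V. fits (I a) V \<Longrightarrow> \<forall>g \<in> G. g a \<le> V \<Longrightarrow> g a \<le> Bg V"
    using polytime_bounded[OF g] by blast
  show ?thesis
  proof (rule polytimeI)
    show "poly_bounded I G (\<lambda>a. h (f a) (g a))"
    proof (rule poly_boundedI[of "\<lambda>V. Bf V + Bg V"])
      fix a V assume "fits (I a) V" "\<forall>g \<in> G. g a \<le> V"
      then have "f a \<le> Bf V" "g a \<le> Bg V" using Bf Bg by auto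
      then show "h (f a) (g a) \<le> Bf V + Bg V" using bound[of "f a" "g a"] by simp
    qed (intro poly_growth_intros Bf Bg)
  next
    fix L :: "(nat \<times> ('a \<Rightarrow> nat)) set" and d :: nat
    assume L: "layout G L d"
    obtain P D T where P: "poly_growth T" "computes P D T I L d f"
      using polytime_program[OF f L] by blast
    obtain P' D' T' where P': "poly_growth T'" "computes P' D' T' I L (d + 1) g"
      using polytime_program[OF g layout_Suc[OF L]] by blast
    have "computes (Seq P (Seq P' (C d))) (D + D' + d + 2) (\<lambda>V. T V + (T' V + (1 + Bf V + Bg V)))
        I L d (\<lambda>a. h (f a) (g a))"
    proof (rule computesI, unfold wp_Seq, rule wp_computes[OF P(2)], assumption)
      fix a R M V t R1
      assume r: "ready I L a V (R, M)" and 1: "t \<le> T V" "R1 d = f a" "\<And>x. x < d \<or> D \<le> x \<Longrightarrow> R1 x = R x"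
      have b: "f a \<le> Bf V" "g a \<le> Bg V" using Bf Bg ready_fits[OF r] ready_bound[OF r L] by auto
      have r1: "ready I L a V (R1, M)" by (rule ready_cong[OF r L]) (use 1 in auto)
      show "wp P' (R1, M) (\<lambda>t2 s2. wp (C d) s2 (\<lambda>t3 s3. t + (t2 + t3) \<le> T V + (T' V + (1 + Bf V + Bg V)) \<and>
          (\<exists>R'. s3 = (R', M) \<and> R' d = h (f a) (g a) \<and> (\<forall>x. x < d \<or> D + D' + d + 2 \<le> x \<longrightarrow> R' x = R x))))"
      proof (rule wp_computes[OF P'(2) r1])
        fix t' R2
        assume 2: "t' \<le> T' V" "R2 (d + 1) = g a" "\<And>x. x < d + 1 \<or> D' \<le> x \<Longrightarrow> R2 x = R1 x"
        show "wp (C d) (R2, M) (\<lambda>t3 s3. t + (t' + t3) \<le> T V + (T' V + (1 + Bf V + Bg V)) \<and>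
          (\<exists>R'. s3 = (R', M) \<and> R' d = h (f a) (g a) \<and> (\<forall>x. x < d \<or> D + D' + d + 2 \<le> x \<longrightarrow> R' x = R x)))"
          by (rule wp_mono[OF C]) (use 1 2 b in auto)
      qed
    qed
    moreover have "poly_growth (\<lambda>V. T V + (T' V + (1 + Bf V + Bg V)))"
      by (intro poly_growth_intros P P' Bf Bg)
    ultimately show "\<exists>P D T. poly_growth T \<and> computes P D T I L d (\<lambda>a. h (f a) (g a))" by blast
  qed
qed

lemma polytime_add:
  assumes "polytime I G f" "polytime I G g" shows "polytime I G (\<lambda>a. f a + g a)"
  by (rule polytime_binary[OF assms, where C = "\<lambda>d. Add d d (d + 1)"])
    (simp_all add: wp_basic add_le_mono bits_le)

lemma polytime_diff:
  assumes "polytime I G f" "polytime I G g" shows "polytime I G (\<lambda>a. f a - g a)"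
  by (rule polytime_binary[OF assms, where C = "\<lambda>d. Sub d d (d + 1)"])
    (simp_all add: wp_basic add_le_mono bits_le)

definition rd :: "nat list \<Rightarrow> nat \<Rightarrow> nat" where
  "rd xs j = (if j < length xs then xs ! j else 0)"

lemma rd_le: "fits xs V \<Longrightarrow> rd xs j \<le> V"
  unfolding rd_def fits_def by simp

lemma polytime_rd:
  assumes f: "polytime I G f" shows "polytime I G (\<lambda>a. rd (I a) (f a))"
proof -
  obtain Bf where Bf: "poly_growth Bf"
    "\<And>a V. fits (I a) V \<Longrightarrow> \<forall>g \<in> G. g a \<le> V \<Longrightarrow> f a \<le> Bf V"
    using polytime_bounded[OF f] by blast
  show ?thesis
  proof (rule polytimeI)
    show "poly_bounded I G (\<lambda>a. rd (I a) (f a))"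
      by (rule poly_boundedI[OF poly_growth_id rd_le])
  next
    fix L :: "(nat \<times> ('a \<Rightarrow> nat)) set" and d :: nat
    assume L: "layout G L d"
    then have d: "0 < d" by (simp add: layout_def)
    obtain P D T where P: "poly_growth T" "computes P D T I L d f"
      using polytime_program[OF f L] by blast
    \<comment> \<open>The position is compared with the length first: cells behind the input may
      already hold output, so an unchecked load need not return the default 0.\<close>
    let ?C = "Seq (Sub (d + 1) 0 d) (Cond (d + 1) (Load d d) (Imm d 0))"
    have "computes (Seq P ?C) (D + d + 2) (\<lambda>V. T V + (3 + 3 * V + 2 * Bf V)) I L d (\<lambda>a. rd (I a) (f a))"
    proof (rule computesI, subst wp_Seq, rule wp_computes[OF P(2)], assumption)
      fix a R M V t R1
      assume r: "ready I L a V (R, M)" and 1: "t \<le> T V" "R1 d = f a" "\<And>x. x < d \<or> D \<le> x \<Longrightarrow> R1 x = R x"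
      have b: "f a \<le> Bf V" using Bf ready_fits[OF r] ready_bound[OF r L] by auto
      have r1: "ready I L a V (R1, M)" by (rule ready_cong[OF r L]) (use 1 in auto)
      have R0: "R1 0 = length (I a)" "length (I a) \<le> V" and M: "\<And>j. j < length (I a) \<Longrightarrow> M j = rd (I a) j"
        using r1 unfolding ready_def fits_def rd_def by auto
      have "bits (R1 0) \<le> V" "bits (R1 d) \<le> Bf V" "bits (R1 0 - R1 d) \<le> V"
        using R0 b 1(2) bits_le[of "R1 0"] bits_le[of "R1 d"] bits_le[of "R1 0 - R1 d"] by linarith+
      moreover have "bits (M (R1 d)) \<le> V" if "R1 d < length (I a)"
        using M[OF that] rd_le[OF ready_fits[OF r]] bits_le le_trans by metis
      ultimately show "wp ?C (R1, M) (\<lambda>t2 s2. t + t2 \<le> T V + (3 + 3 * V + 2 * Bf V) \<and>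
          (\<exists>R'. s2 = (R', M) \<and> R' d = rd (I a) (f a) \<and> (\<forall>x. x < d \<or> D + d + 2 \<le> x \<longrightarrow> R' x = R x)))"
        using 1 R0(1) M d by (cases "f a < length (I a)") (auto simp add: wp_basic wp_Cond rd_def)
    qed
    moreover have "poly_growth (\<lambda>V. T V + (3 + 3 * V + 2 * Bf V))"
      by (intro poly_growth_intros P Bf)
    ultimately show "\<exists>P D T. poly_growth T \<and> computes P D T I L d (\<lambda>a. rd (I a) (f a))" by blast
  qed
qed

lemma polytime_if_nonzero:
  assumes c: "polytime I G c" and f: "polytime I G f" and g: "polytime I G g"
  shows "polytime I G (\<lambda>a. if c a \<noteq> 0 then f a else g a)"
proof -
  obtain Bc where Bc: "poly_growth Bc"
    "\<And>a V. fits (I a) V \<Longrightarrow> \<forall>g \<in> G. g a \<le> V \<Longrightarrow> c a \<le> Bc V"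
    using polytime_bounded[OF c] by blast
  obtain Bf where Bf: "poly_growth Bf"
    "\<And>a V. fits (I a) V \<Longrightarrow> \<forall>g \<in> G. g a \<le> V \<Longrightarrow> f a \<le> Bf V"
    using polytime_bounded[OF f] by blast
  obtain Bg where Bg: "poly_growth Bg"
    "\<And>a V. fits (I a) V \<Longrightarrow> \<forall>g \<in> G. g a \<le> V \<Longrightarrow> g a \<le> Bg V"
    using polytime_bounded[OF g] by blast
  show ?thesis
  proof (rule polytimeI)
    show "poly_bounded I G (\<lambda>a. if c a \<noteq> 0 then f a else g a)"
      by (rule poly_boundedI[of "\<lambda>V. Bf V + Bg V"]) 
        (use Bf Bg in \<open>auto intro: poly_growth_intros trans_le_add1 trans_le_add2\<close>)
  next
    fix L :: "(nat \<times> ('a \<Rightarrow> nat)) set" and d :: nat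
    assume L: "layout G L d"
    obtain Pc Dc Tc where Pc: "poly_growth Tc" "computes Pc Dc Tc I L d c"
      using polytime_program[OF c L] by blast
    obtain Pf Df Tf where Pf: "poly_growth Tf" "computes Pf Df Tf I L d f"
      using polytime_program[OF f L] by blast
    obtain Pg Dg Tg where Pg: "poly_growth Tg" "computes Pg Dg Tg I L d g"
      using polytime_program[OF g L] by blast
    have "computes (Seq Pc (Cond d Pf Pg)) (Dc + Df + Dg) (\<lambda>V. Tc V + (1 + Bc V + (Tf V + Tg V))) I L d
        (\<lambda>a. if c a \<noteq> 0 then f a else g a)"
    proof (rule computesI, unfold wp_Seq, rule wp_computes[OF Pc(2)], assumption)
      fix a R M V t R1
      assume r: "ready I L a V (R, M)" and 1: "t \<le> Tc V" "R1 d = c a" "\<And>x. x < d \<or> Dc \<le> x \<Longrightarrow> R1 x = R x"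
      have "c a \<le> Bc V" using Bc ready_fits[OF r] ready_bound[OF r L] by auto
      then have b: "bits (R1 d) \<le> Bc V" using bits_le[of "R1 d"] 1 by simp
      have r1: "ready I L a V (R1, M)" by (rule ready_cong[OF r L]) (use 1 in auto)
      show "wp (Cond d Pf Pg) (R1, M) (\<lambda>t2 s2. t + t2 \<le> Tc V + (1 + Bc V + (Tf V + Tg V)) \<and>
          (\<exists>R'. s2 = (R', M) \<and> R' d = (if c a \<noteq> 0 then f a else g a) \<and>
             (\<forall>x. x < d \<or> Dc + Df + Dg \<le> x \<longrightarrow> R' x = R x)))"
      proof (cases "c a = 0")
        case True
        then show ?thesis unfolding wp_Cond 1(2)
          by simp (rule wp_computes[OF Pg(2) r1], use 1 b in auto)
      next
        case False
        then show ?thesis unfolding wp_Cond 1(2)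
          by simp (rule wp_computes[OF Pf(2) r1], use 1 b in auto)
      qed
    qed
    moreover have "poly_growth (\<lambda>V. Tc V + (1 + Bc V + (Tf V + Tg V)))"
      by (intro poly_growth_intros Pc Pf Pg Bc)
    ultimately show "\<exists>P D T. poly_growth T \<and> computes P D T I L d (\<lambda>a. if c a \<noteq> 0 then f a else g a)" by blast
  qed
qed

section \<open>Recursion with polynomially bounded values\<close>

definition with_index :: "('a \<Rightarrow> nat) set \<Rightarrow> ('a \<times> nat \<Rightarrow> nat) set" where
  "with_index G = insert snd ((\<lambda>g p. g (fst p)) ` G)"

text \<open>Inside a loop the argument is the old one paired with an index. A program for
  \<open>f\<close> still runs there: the registers whose contents depend only on the first component
  form a layout for it. Lifting twice serves nested loops.\<close>

lemma polytime_lift: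
  assumes f: "polytime I G f" shows "polytime (\<lambda>p. I (fst p)) (with_index G) (\<lambda>p. f (fst p))"
proof (rule polytimeI)
  obtain B where "poly_growth B"
    "\<And>a V. fits (I a) V \<Longrightarrow> \<forall>g \<in> G. g a \<le> V \<Longrightarrow> f a \<le> B V"
    using polytime_bounded[OF f] by blast
  then show "poly_bounded (\<lambda>p. I (fst p)) (with_index G) (\<lambda>p. f (fst p))"
    by (intro poly_boundedI) (auto simp: with_index_def)
next
  fix L :: "(nat \<times> ('a \<times> nat \<Rightarrow> nat)) set" and d
  assume L: "layout (with_index G) L d"
  let ?L = "{(x, g). (x, \<lambda>p. g (fst p)) \<in> L}"
  have "layout G ?L d"
    unfolding layout_def
  proof (intro conjI subsetI)
    fix g assume "g \<in> G"
    then obtain x where "(x, \<lambda>p. g (fst p)) \<in> L"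
      using L unfolding layout_def with_index_def by force
    then show "g \<in> snd ` ?L" by force
  qed (use L in \<open>auto simp: layout_def\<close>)
  from polytime_program[OF f this] obtain P D T where P: "poly_growth T" "computes P D T I ?L d f" by blast
  have "computes P D T (\<lambda>p. I (fst p)) L d (\<lambda>p. f (fst p))"
  proof (rule computesI)
    fix p R M V assume "ready (\<lambda>p. I (fst p)) L p V (R, M)"
    then have "ready I ?L (fst p) V (R, M)" unfolding ready_def by fastforce
    then show "wp P (R, M) (\<lambda>t s. t \<le> T V \<and> (\<exists>R'. s = (R', M) \<and> R' d = f (fst p) \<and>
        (\<forall>x. x < d \<or> D \<le> x \<longrightarrow> R' x = R x)))"
      by (rule wp_computes[OF P(2)]) blast
  qed
  with P show "\<exists>P D T. poly_growth T \<and> computes P D T (\<lambda>p. I (fst p)) L d (\<lambda>p. f (fst p))" by blast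
qed

lemma polytime_bound_var: "polytime I (with_index G) snd"
  by (rule polytime_var) (simp add: with_index_def)

text \<open>Iterating a polynomially bounded step can produce exponentially large values, so the
  growth of the recursion is a separate hypothesis. It covers every index, since all intermediate
  values pass through a register.\<close>

lemma polytime_rec:
  assumes n: "polytime I G n" and z: "polytime I G z"
    and step: "polytime (\<lambda>p. I (fst (fst p))) (with_index (with_index G)) (\<lambda>p. h (fst (fst p)) (snd (fst p)) (snd p))"
    and bound: "poly_bounded (\<lambda>p. I (fst p)) (with_index G) (\<lambda>p. rec_nat (z (fst p)) (h (fst p)) (snd p))"
  shows "polytime I G (\<lambda>a. rec_nat (z a) (h a) (n a))"
proof -
  obtain Bn where Bn: "poly_growth Bn"
    "\<And>a V. fits (I a) V \<Longrightarrow> \<forall>g \<in> G. g a \<le> V \<Longrightarrow> n a \<le> Bn V"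
    using polytime_bounded[OF n] by blast
  obtain Br' where Br': "poly_growth Br'"
    "\<And>p V. fits (I (fst p)) V \<Longrightarrow> \<forall>g \<in> with_index G. g p \<le> V \<Longrightarrow> rec_nat (z (fst p)) (h (fst p)) (snd p) \<le> Br' V"
    using bound unfolding poly_bounded_def by blast
  \<comment> \<open>The indices that occur are at most \<open>n a \<le> Bn V\<close>, so
    \<open>V + Bn V\<close> bounds the input and the index together.\<close>
  define Br where "Br = (\<lambda>V. Br' (V + Bn V))"
  have Br: "poly_growth Br" unfolding Br_def
    by (intro poly_growth_compose[OF Br'(1)] poly_growth_intros Bn)
  have Br_bound: "rec_nat (z a) (h a) i \<le> Br V"
    if "fits (I a) V" "\<forall>g \<in> G. g a \<le> V" "i \<le> n a" for a V i
  proof -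
    have "fits (I a) (V + Bn V)" using that fits_mono by fastforce
    moreover have "\<forall>g \<in> with_index G. g (a, i) \<le> V + Bn V"
      using that Bn(2)[of a V] by (auto simp: with_index_def trans_le_add1)
    ultimately show ?thesis using Br'(2)[of "(a, i)" "V + Bn V"] by (simp add: Br_def)
  qed
  show ?thesis
  proof (rule polytimeI)
    show "poly_bounded I G (\<lambda>a. rec_nat (z a) (h a) (n a))"
      by (rule poly_boundedI[OF Br]) (simp add: Br_bound)
  next
    fix L :: "(nat \<times> ('a \<Rightarrow> nat)) set" and d :: nat
    assume L: "layout G L d"
    then have d: "0 < d" by (simp add: layout_def)
    obtain Pn Dn Tn where Pn: "poly_growth Tn" "computes Pn Dn Tn I L d n"
      using polytime_program[OF n L] by blast
    obtain Pz Dz Tz where Pz: "poly_growth Tz" "computes Pz Dz Tz I L (d + 1) z"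
      using polytime_program[OF z layout_Suc[OF L]] by blast
    \<comment> \<open>Register \<open>d\<close> counts the remaining rounds, \<open>d + 1\<close> is
      the accumulator and \<open>d + 2\<close> the index; the body sees them as the argument
      \<open>((a, i), r)\<close>.\<close>
    define L' where "L' = insert (d + 1, snd) (insert (d + 2, \<lambda>p. snd (fst p))
      ((\<lambda>(x, g). (x, \<lambda>p :: ('a \<times> nat) \<times> nat. g (fst (fst p)))) ` L))"
    have L': "layout (with_index (with_index G)) L' (d + 3)"
      unfolding layout_def
    proof (intro conjI subsetI)
      fix k assume "k \<in> with_index (with_index G)"
      then consider "k = snd" | "k = (\<lambda>p. snd (fst p))" | g where "g \<in> G" "k = (\<lambda>p. g (fst (fst p)))"
        unfolding with_index_def by auto
      then show "k \<in> snd ` L'"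
      proof cases
        case 3
        then obtain x where "(x, g) \<in> L" using L unfolding layout_def by force
        then have "(x, k) \<in> L'" using 3 unfolding L'_def by force
        then show ?thesis by force
      qed (auto simp: L'_def)
    next
      show "\<forall>x g. (x, g) \<in> L' \<longrightarrow> x < d + 3"
        using L unfolding layout_def L'_def by fastforce
    qed simp
    obtain Ps Ds Ts where Ps: "poly_growth Ts" "computes Ps Ds Ts (\<lambda>p. I (fst (fst p))) L' (d + 3)
        (\<lambda>p. h (fst (fst p)) (snd (fst p)) (snd p))"
      using polytime_program[OF step L'] by blast
    \<comment> \<open>There are no copy or increment instructions: register \<open>d + 4\<close>
      holds 0 for moving the new accumulator, then 1 for stepping both counters.\<close>
    let ?upd = "Seq (Imm (d + 4) 0) (Seq (Add (d + 1) (d + 3) (d + 4)) (Seq (Imm (d + 4) 1)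
      (Seq (Add (d + 2) (d + 2) (d + 4)) (Sub d d (d + 4)))))"
    define D where "D = Dn + Dz + Ds + d + 5"
    define S where "S = (\<lambda>V. Ts (V + Bn V + Br V))"
    define Tb where "Tb = (\<lambda>V. S V + (10 + Br V + 2 * Bn V))"
    define TT where "TT = (\<lambda>V. Tn V + (Tz V + (1 + (Bn V + 1) * (Bn V + 1 + Tb V) + (1 + Br V))))"
    have "computes (Seq Pn (Seq Pz (Seq (Imm (d + 2) 0) (Seq (While d (Seq Ps ?upd)) (Add d d (d + 1)))))) D TT I L d
        (\<lambda>a. rec_nat (z a) (h a) (n a))"
    proof (rule computesI, unfold wp_Seq[of Pn], rule wp_computes[OF Pn(2)], assumption)
      fix a R M V t R1
      assume r: "ready I L a V (R, M)" and 1: "t \<le> Tn V" "R1 d = n a" "\<And>x. x < d \<or> Dn \<le> x \<Longrightarrow> R1 x = R x"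
      let ?F = "rec_nat (z a) (h a)"
      \<comment> \<open>A common bound for the input, the index and the accumulator, as the body
        requires.\<close>
      let ?V = "V + Bn V + Br V"
      have na: "n a \<le> Bn V" using Bn ready_fits[OF r] ready_bound[OF r L] by auto
      have F: "?F i \<le> Br V" if "i \<le> n a" for i
        using Br_bound[OF ready_fits[OF r] ready_bound[OF r L] that] .
      have r1: "ready I L a V (R1, M)" by (rule ready_cong[OF r L]) (use 1 in auto)
      define Inv where "Inv i s \<longleftrightarrow> (\<exists>R2. s = (R2, M) \<and> R2 d = n a - i \<and> R2 (d + 1) = ?F i \<and> R2 (d + 2) = i \<and>
          (\<forall>x. x < d \<or> D \<le> x \<longrightarrow> R2 x = R x))" for i s
      have loop: "wp (While d (Seq Ps ?upd)) s0 (\<lambda>t s. t \<le> (n a + 1) * (n a + 1 + Tb V) \<and> Inv (n a) s)"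
        if "Inv 0 s0" for s0
      proof (rule wp_While)
        fix i s assume i: "i < n a" and "Inv i s"
        then obtain R2 where s: "s = (R2, M)" and R2: "R2 d = n a - i" "R2 (d + 1) = ?F i" "R2 (d + 2) = i"
          "\<And>x. x < d \<or> D \<le> x \<Longrightarrow> R2 x = R x" unfolding Inv_def by blast
        have "ready I L a V (R2, M)" by (rule ready_cong[OF r L]) (use R2 in auto)
        moreover have "\<forall>x g. (x, g) \<in> L \<longrightarrow> g a \<le> ?V"
          using r unfolding ready_def by (simp add: trans_le_add1)
        ultimately have r2: "ready (\<lambda>p. I (fst (fst p))) L' ((a, i), ?F i) ?V (R2, M)"
          using R2(2,3) F[of i] na i fits_mono[OF ready_fits[OF r], of ?V]
          unfolding ready_def L'_def by (auto intro: trans_le_add1)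
        show "wp (Seq Ps ?upd) s (\<lambda>t s'. t \<le> Tb V \<and> Inv (Suc i) s')"
          unfolding s wp_Seq[of Ps]
        proof (rule wp_computes[OF Ps(2) r2])
          fix t3 R3 assume 3: "t3 \<le> Ts ?V" "R3 (d + 3) = h (fst (fst ((a, i), ?F i))) (snd (fst ((a, i), ?F i))) (snd ((a, i), ?F i))"
            "\<And>x. x < d + 3 \<or> Ds \<le> x \<Longrightarrow> R3 x = R2 x"
          have R3: "R3 (d + 3) = ?F (Suc i)" "R3 d = n a - i" "R3 (d + 2) = i"
            "\<And>x. x < d \<or> D \<le> x \<Longrightarrow> R3 x = R x" using 3 R2 by (auto simp: D_def)
          have "bits (?F (Suc i)) \<le> Br V" "bits i \<le> Bn V" "bits (n a - i) \<le> Bn V" "bits (Suc 0) \<le> 1"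
            using F[of "Suc i"] i na bits_le[of "?F (Suc i)"] bits_le[of i] bits_le[of "n a - i"] bits_le[of "Suc 0"] by linarith+
          then show "wp ?upd (R3, M) (\<lambda>t2 s2. t3 + t2 \<le> Tb V \<and> Inv (Suc i) s2)"
            using 3(1) R3 by (simp add: wp_basic Inv_def Tb_def S_def D_def del: old.nat.simps)
        qed
      qed (use that in \<open>auto simp: Inv_def\<close>)
      show "wp (Seq Pz (Seq (Imm (d + 2) 0) (Seq (While d (Seq Ps ?upd)) (Add d d (d + 1))))) (R1, M) (\<lambda>t2 s2. t + t2 \<le> TT V \<and>
          (\<exists>R'. s2 = (R', M) \<and> R' d = ?F (n a) \<and> (\<forall>x. x < d \<or> D \<le> x \<longrightarrow> R' x = R x)))"
        unfolding wp_Seq[of Pz]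
      proof (rule wp_computes[OF Pz(2) r1])
        fix t2 R2
        assume 2: "t2 \<le> Tz V" "R2 (d + 1) = z a" "\<And>x. x < d + 1 \<or> Dz \<le> x \<Longrightarrow> R2 x = R1 x"
        have I0: "Inv 0 (R2(d + 2 := 0), M)"
          using 1 2 unfolding Inv_def D_def by simp
        have *: "(n a + 1) * (n a + 1 + Tb V) \<le> (Bn V + 1) * (Bn V + 1 + Tb V)"
            "bits (?F (n a)) \<le> Br V"
          using na F[of "n a"] bits_le[of "?F (n a)"] by (auto intro!: mult_le_mono simp del: mult_Suc mult_Suc_right)
        show "wp (Seq (Imm (d + 2) 0) (Seq (While d (Seq Ps ?upd)) (Add d d (d + 1)))) (R2, M)
          (\<lambda>t3 s3. t + (t2 + t3) \<le> TT V \<and>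
          (\<exists>R'. s3 = (R', M) \<and> R' d = ?F (n a) \<and> (\<forall>x. x < d \<or> D \<le> x \<longrightarrow> R' x = R x)))"
          unfolding wp_Seq[of "Imm _ _"] wp_Imm wp_Seq[of "While _ _"]
        proof (rule wp_mono[OF loop[OF I0]], elim conjE)
          fix t3 s3 assume t3: "t3 \<le> (n a + 1) * (n a + 1 + Tb V)" and "Inv (n a) s3"
          then obtain R3 where R3: "s3 = (R3, M)" "R3 d = 0" "R3 (d + 1) = ?F (n a)"
            "\<And>x. x < d \<or> D \<le> x \<Longrightarrow> R3 x = R x" unfolding Inv_def by auto
          show "wp (Add d d (d + 1)) s3 (\<lambda>t4 s4. t + (t2 + (1 + bits 0 + (t3 + t4))) \<le> TT V \<and>
            (\<exists>R'. s4 = (R', M) \<and> R' d = ?F (n a) \<and> (\<forall>x. x < d \<or> D \<le> x \<longrightarrow> R' x = R x)))"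
            unfolding R3(1) wp_Add using *(1,2) t3 1(1) 2(1) R3(2-4)
            by (simp add: TT_def D_def bits_0)
        qed
      qed
    qed
    moreover have "poly_growth TT" unfolding TT_def Tb_def S_def
      by (intro poly_growth_intros poly_growth_compose[OF Ps(1)] Pn Pz Bn Br)
    ultimately show "\<exists>P D T. poly_growth T \<and> computes P D T I L d (\<lambda>a. rec_nat (z a) (h a) (n a))" by blast
  qed
qed

section \<open>Predicates, sums, division and finite tables\<close>

lemma polytime_cong: "(\<And>a. f a = g a) \<Longrightarrow> polytime I G f \<Longrightarrow> polytime I G g"
  by presburger

lemma polytime_If:
  assumes "polytime I G (\<lambda>a. of_bool (Q a))" "polytime I G f" "polytime I G g"
  shows "polytime I G (\<lambda>a. if Q a then f a else g a)"
  by (rule polytime_cong[OF _ polytime_if_nonzero[OF assms]]) auto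

lemma polytime_less:
  assumes "polytime I G f" "polytime I G g" shows "polytime I G (\<lambda>a. of_bool (f a < g a))"
  by (rule polytime_cong[OF _ polytime_if_nonzero[OF polytime_diff[OF assms(2,1)] polytime_const[of _ _ 1] polytime_const[of _ _ 0]]]) auto

lemma polytime_not:
  assumes "polytime I G (\<lambda>a. of_bool (Q a))" shows "polytime I G (\<lambda>a. of_bool (\<not> Q a))"
  by (rule polytime_cong[OF _ polytime_diff[OF polytime_const[of _ _ 1] assms]]) auto

lemma polytime_conj:
  assumes "polytime I G (\<lambda>a. of_bool (Q a))" "polytime I G (\<lambda>a. of_bool (Q' a))"
  shows "polytime I G (\<lambda>a. of_bool (Q a \<and> Q' a))"
  by (rule polytime_cong[OF _ polytime_If[OF assms polytime_const[of _ _ 0]]]) auto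

lemma polytime_disj:
  assumes "polytime I G (\<lambda>a. of_bool (Q a))" "polytime I G (\<lambda>a. of_bool (Q' a))"
  shows "polytime I G (\<lambda>a. of_bool (Q a \<or> Q' a))"
  by (rule polytime_cong[OF _ polytime_If[OF assms(1) polytime_const[of _ _ 1] assms(2)]]) auto

lemma polytime_iff:
  assumes "polytime I G (\<lambda>a. of_bool (Q a))" "polytime I G (\<lambda>a. of_bool (Q' a))"
  shows "polytime I G (\<lambda>a. of_bool (Q a \<longleftrightarrow> Q' a))"
  by (rule polytime_cong[OF _ polytime_If[OF assms(1) assms(2) polytime_not[OF assms(2)]]]) auto

lemma polytime_le:
  assumes "polytime I G f" "polytime I G g" shows "polytime I G (\<lambda>a. of_bool (f a \<le> g a))"
  by (rule polytime_cong[OF _ polytime_not[OF polytime_less[OF assms(2,1)]]]) auto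

lemma polytime_eq:
  assumes "polytime I G f" "polytime I G g" shows "polytime I G (\<lambda>a. of_bool (f a = g a))"
  by (rule polytime_cong[OF _ polytime_conj[OF polytime_le[OF assms] polytime_le[OF assms(2,1)]]]) auto

text \<open>A sum of polynomially many bounded terms stays bounded. Products, bounded existential
  quantifiers and quotients are all obtained as such sums.\<close>

lemma polytime_sum:
  assumes n: "polytime I G n" and f: "polytime (\<lambda>p. I (fst p)) (with_index G) (\<lambda>p. f (fst p) (snd p))"
  shows "polytime I G (\<lambda>a. \<Sum>i<n a. f a i)"
proof (rule polytime_cong)
  show "rec_nat 0 (\<lambda>i r. r + f a i) (n a) = (\<Sum>i<n a. f a i)" for a
    by (induction "n a") (auto simp: add.commute intro: nat.induct)
  obtain B where B: "poly_growth B"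
    "\<And>p V. fits (I (fst p)) V \<Longrightarrow> \<forall>g \<in> with_index G. g p \<le> V \<Longrightarrow> f (fst p) (snd p) \<le> B V"
    using polytime_bounded[OF f] by blast
  show "polytime I G (\<lambda>a. rec_nat 0 (\<lambda>i r. r + f a i) (n a))"
  proof (rule polytime_rec[OF n polytime_const])
    show "polytime (\<lambda>p. I (fst (fst p))) (with_index (with_index G)) (\<lambda>p. snd p + f (fst (fst p)) (snd (fst p)))"
      by (intro polytime_add polytime_bound_var polytime_lift[OF f])
    show "poly_bounded (\<lambda>p. I (fst p)) (with_index G) (\<lambda>p. rec_nat 0 (\<lambda>i r. r + f (fst p) i) (snd p))"
    proof (rule poly_boundedI[of "\<lambda>V. V * B V"])
      fix p V assume V: "fits (I (fst p)) V" "\<forall>g \<in> with_index G. g p \<le> V"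
      have i: "snd p \<le> V" using V by (simp add: with_index_def)
      have "f (fst p) j \<le> B V" if "j \<le> V" for j
        using B(2)[of "(fst p, j)" V] V that by (auto simp: with_index_def)
      then have "j \<le> V \<Longrightarrow> rec_nat 0 (\<lambda>i r. r + f (fst p) i) j \<le> j * B V" for j
        by (induction j) (auto simp: add.commute intro: add_mono)
      with i have "rec_nat 0 (\<lambda>i r. r + f (fst p) i) (snd p) \<le> snd p * B V" by blast
      also have "\<dots> \<le> V * B V" using i by simp
      finally show "rec_nat 0 (\<lambda>i r. r + f (fst p) i) (snd p) \<le> V * B V" .
    qed (intro poly_growth_intros B)
  qed
qed

lemma polytime_ex:
  assumes "polytime I G n" "polytime (\<lambda>p. I (fst p)) (with_index G) (\<lambda>p. of_bool (Q (fst p) (snd p)))"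
  shows "polytime I G (\<lambda>a. of_bool (\<exists>i<n a. Q a i))"
  by (rule polytime_cong[OF _ polytime_less[OF polytime_const[of _ _ 0] polytime_sum[OF assms]]]) (auto simp: sum_eq_0_iff)

lemma polytime_mult:
  assumes "polytime I G f" "polytime I G g" shows "polytime I G (\<lambda>a. f a * g a)"
  by (rule polytime_cong[OF _ polytime_sum[OF assms(1) polytime_lift[OF assms(2)]]]) simp

text \<open>The quotient counts the positive multiples of \<open>k\<close> up to \<open>m\<close>.
  As it is at most \<open>m\<close>, the sum may stop there.\<close>

lemma div_eq_sum: "(m :: nat) div k = (if k = 0 then 0 else \<Sum>i<m. of_bool ((i + 1) * k \<le> m))"
proof (cases "k = 0")
  case False
  then have "{i. i < m \<and> (i + 1) * k \<le> m} = {i. i + 1 \<le> m div k}"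
    using less_eq_div_iff_mult_less_eq[of k _ m] div_le_dividend[of m k] by (auto simp del: mult_Suc div_le_dividend) (metis Suc_le_lessD le_trans)
  then have "card {i. i < m \<and> (i + 1) * k \<le> m} = m div k" by (simp add: Suc_le_eq)
  moreover have "(\<Sum>i<m. of_bool ((i + 1) * k \<le> m)) = card {i. i < m \<and> (i + 1) * k \<le> m}"
    by (simp add: sum.If_cases of_bool_def Int_def del: mult_Suc)
  ultimately show ?thesis using False by simp
qed simp

lemma polytime_div:
  assumes "polytime I G f" "polytime I G g" shows "polytime I G (\<lambda>a. f a div g a)"
  unfolding div_eq_sum
  by (intro polytime_If polytime_eq polytime_const assms polytime_sum polytime_le polytime_mult polytime_add polytime_bound_var polytime_lift[OF assms(1)] polytime_lift[OF assms(2)])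

lemma polytime_mod:
  assumes "polytime I G f" "polytime I G g" shows "polytime I G (\<lambda>a. f a mod g a)"
  by (rule polytime_cong[OF minus_div_mult_eq_mod]) (intro polytime_diff polytime_mult polytime_div assms)

text \<open>A function on finitely many residues is a fixed cascade of case distinctions. Nothing
  effective is asked of \<open>f\<close>, which is how the merely existing data
  \<open>tuple\<close>, \<open>large\<close> and \<open>dec\<close> get into the program.\<close>

lemma polytime_table:
  assumes g: "polytime I G g" and "0 < B" shows "polytime I G (\<lambda>a. f (g a mod B))"
proof -
  have m: "polytime I G (\<lambda>a. g a mod B)" by (intro polytime_mod g polytime_const)
  have "polytime I G (\<lambda>a. if g a mod B < C then f (g a mod B) else 0)" for C
  proof (induction C)
    case 0
    show ?case by (simp add: polytime_const)
  next
    case (Suc C)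
    have "polytime I G (\<lambda>a. if g a mod B = C then f C else if g a mod B < C then f (g a mod B) else 0)"
      by (intro polytime_If polytime_eq m polytime_const Suc)
    then show ?case by (rule polytime_cong[rotated]) auto
  qed
  from this[of B] \<open>0 < B\<close> show ?thesis by simp
qed

text \<open>The three residues are packed into one number in mixed radix.\<close>

lemma polytime_table3:
  assumes u: "polytime I G u" and v: "polytime I G v" and w: "polytime I G w" and pos: "0 < A" "0 < B" "0 < C"
  shows "polytime I G (\<lambda>a. f (u a mod A) (v a mod B) (w a mod C))"
proof -
  let ?x = "\<lambda>a. (u a mod A * B + v a mod B) * C + w a mod C"
  have "polytime I G (\<lambda>a. (\<lambda>x. f (x div C div B) (x div C mod B) (x mod C)) (?x a mod (A * B * C)))"
    by (rule polytime_table) (use pos in \<open>auto intro!: polytime_add polytime_mult polytime_mod polytime_const u v w\<close>)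
  moreover have "?x a < A * B * C" for a
  proof -
    have "u a mod A * B + v a mod B < A * B"
    proof -
      have "Suc (u a mod A) * B \<le> A * B" using pos by (intro mult_le_mono1) (simp add: Suc_le_eq)
      moreover have "v a mod B < B" using pos by simp
      ultimately show ?thesis unfolding mult_Suc by linarith
    qed
    then have "Suc (u a mod A * B + v a mod B) * C \<le> A * B * C" by (intro mult_le_mono1) simp
    moreover have "w a mod C < C" using pos by simp
    ultimately show ?thesis unfolding mult_Suc by linarith
  qed
  ultimately show ?thesis using pos by simp
qed

section \<open>Reductions as programs\<close>

text \<open>
  The output is first written behind the input, then moved down over it; the cells and registers left over are
  erased, so that the next program starts in a genuine initial state.
\<close>

fun clear_regs :: "nat \<Rightarrow> com" where
  "clear_regs 0 = Imm 1 0"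
| "clear_regs (Suc n) = Seq (clear_regs n) (Imm (Suc n) 0)"

text \<open>There is no empty program, so the base case clears register 1; this explains
  \<open>max 1 n\<close>.\<close>

lemma wp_clear_regs:
  "wp (clear_regs n) (R, M) (\<lambda>t s. t \<le> n + 1 \<and> s = ((\<lambda>x. if 0 < x \<and> x \<le> max 1 n then 0 else R x), M))"
proof (induction n)
  case 0
  show ?case by (auto simp: wp_basic fun_eq_iff)
next
  case (Suc n)
  show ?case unfolding clear_regs.simps wp_Seq
    by (rule wp_mono[OF Suc]) (auto simp: wp_basic fun_eq_iff)
qed

lemma input_size_le:
  assumes "\<And>x. x \<in> set xs \<Longrightarrow> x \<le> B"
  shows "input_size xs \<le> length xs * (1 + B)"
  using assms
proof (induction xs)
  case (Cons x xs)
  have "bits x \<le> B" using Cons.prems[of x] bits_le[of x] by simp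
  moreover have "input_size xs \<le> length xs * (1 + B)" using Cons by simp
  ultimately show ?case by (simp add: input_size_def)
qed (simp add: input_size_def)

text \<open>Registers of the three loops: 0 holds the input length, 1 the remaining rounds, 2 the
  output length, 3 the current index or address, 4 the value being stored, 5 is scratch.\<close>

definition write_body where
  "write_body P = Seq P (Seq (Add 5 0 3) (Seq (Store 5 4) (Seq (Imm 5 1) (Seq (Add 3 3 5) (Sub 1 1 5)))))"

definition copy_body where
  "copy_body = Seq (Add 5 0 3) (Seq (Load 4 5) (Seq (Store 3 4) (Seq (Imm 5 1) (Seq (Add 3 3 5) (Sub 1 1 5)))))"

definition erase_body where
  "erase_body = Seq (Store 3 4) (Seq (Imm 5 1) (Seq (Add 3 3 5) (Sub 1 1 5)))"

lemma wp_copy_step: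
  assumes "l \<le> V" "n \<le> V" "M (l + i) \<le> V" "i < n" "R 0 = l" "R (Suc 0) = n - i" "R 2 = n" "R 3 = i"
  shows "wp copy_body (R, M) (\<lambda>t s. t \<le> 10 + 9 * V \<and> (\<exists>R'. s = (R', M(i := M (l + i))) \<and>
       R' 0 = l \<and> R' (Suc 0) = n - Suc i \<and> R' 2 = n \<and> R' 3 = Suc i \<and> (\<forall>x \<ge> 6. R' x = R x)))"
proof -
  have "bits l \<le> V" "bits i \<le> V" "bits (M (l + i)) \<le> V" "bits (l + i) \<le> 2 * V" "bits (n - i) \<le> V" "bits (Suc 0) \<le> 1"
    using assms(1-4) bits_le[of l] bits_le[of i] bits_le[of "M (l + i)"] bits_le[of "l + i"]
      bits_le[of "n - i"] bits_le[of "Suc 0"] by linarith+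
  with assms show ?thesis by (simp add: wp_basic copy_body_def)
qed

lemma wp_erase_step:
  assumes "l \<le> V" "n \<le> V" "i < l" "R (Suc 0) = l - i" "R 2 = n" "R 3 = n + i" "R 4 = 0"
  shows "wp erase_body (R, M) (\<lambda>t s. t \<le> 10 + 5 * V \<and> (\<exists>R'. s = (R', M(n + i := 0)) \<and>
       R' (Suc 0) = l - Suc i \<and> R' 2 = n \<and> R' 3 = n + Suc i \<and> R' 4 = 0 \<and> (\<forall>x \<ge> 6. R' x = R x)))"
proof -
  have "bits (n + i) \<le> 2 * V" "bits (l - i) \<le> V" "bits (Suc 0) \<le> 1"
    using assms(1-3) bits_le[of "n + i"] bits_le[of "l - i"] bits_le[of "Suc 0"] by linarith+
  with assms show ?thesis by (simp add: wp_basic erase_body_def)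
qed

text \<open>Source and destination may overlap, but copying upwards is safe: before round
  \<open>i\<close> only cells below \<open>i\<close> have changed, and \<open>l + i\<close> is not
  one of them.\<close>

lemma wp_copy_loop:
  assumes "l \<le> V" "n \<le> V" "\<And>j. M j \<le> V" "R 0 = l" "R 1 = n" "R 2 = n" "R 3 = 0"
  shows "wp (While 1 copy_body) (R, M) (\<lambda>t s. t \<le> (n + 1) * (n + 1 + (10 + 9 * V)) \<and>
    (\<exists>R'. s = (R', \<lambda>j. if j < n then M (l + j) else M j) \<and>
       R' 0 = l \<and> R' 2 = n \<and> R' 3 = n \<and> (\<forall>x \<ge> 6. R' x = R x)))"
proof -
  define Inv where "Inv i s \<longleftrightarrow> (\<exists>R'. s = (R', \<lambda>j. if j < i then M (l + j) else M j) \<and>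
     R' 0 = l \<and> R' (Suc 0) = n - i \<and> R' 2 = n \<and> R' 3 = i \<and> (\<forall>x \<ge> 6. R' x = R x))" for i s
  have "wp (While 1 copy_body) (R, M) (\<lambda>t s. t \<le> (n + 1) * (n + 1 + (10 + 9 * V)) \<and> Inv n s)"
  proof (rule wp_While)
    fix i s assume i: "i < n" and "Inv i s"
    then obtain R' where s: "s = (R', \<lambda>j. if j < i then M (l + j) else M j)" and
      R': "R' 0 = l" "R' (Suc 0) = n - i" "R' 2 = n" "R' 3 = i" "\<forall>x \<ge> 6. R' x = R x"
      unfolding Inv_def by blast
    have "(\<lambda>j. if j < i then M (l + j) else M j) (l + i) \<le> V" using assms(3) by simp
    note step = wp_copy_step[where M = "\<lambda>j. if j < i then M (l + j) else M j" and R = R', OF assms(1,2) this i R'(1-4)]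
    have upd: "(\<lambda>j. if j < i then M (l + j) else M j)(i := (\<lambda>j. if j < i then M (l + j) else M j) (l + i))
        = (\<lambda>j. if j < Suc i then M (l + j) else M j)"
      by (auto simp: fun_eq_iff less_Suc_eq)
    show "wp copy_body s (\<lambda>t s'. t \<le> 10 + 9 * V \<and> Inv (Suc i) s')"
      unfolding s by (rule wp_mono[OF step[unfolded upd]]) (use R'(5) in \<open>auto simp: Inv_def\<close>)
  qed (use assms in \<open>auto simp: Inv_def\<close>)
  then show ?thesis by (rule wp_mono) (auto simp: Inv_def)
qed

text \<open>The written data ends at \<open>n + l\<close>, so once the output occupies the first
  \<open>n\<close> cells, exactly the \<open>l\<close> cells behind it can be left over.\<close>

lemma wp_erase_loop:
  assumes "l \<le> V" "n \<le> V" "R 1 = l" "R 2 = n" "R 3 = n" "R 4 = 0"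
  shows "wp (While 1 erase_body) (R, M) (\<lambda>t s. t \<le> (l + 1) * (l + 1 + (10 + 5 * V)) \<and>
    (\<exists>R'. s = (R', \<lambda>j. if n \<le> j \<and> j < n + l then 0 else M j) \<and>
       R' 2 = n \<and> (\<forall>x \<ge> 6. R' x = R x)))"
proof -
  define Inv where "Inv i s \<longleftrightarrow> (\<exists>R'. s = (R', \<lambda>j. if n \<le> j \<and> j < n + i then 0 else M j) \<and>
     R' (Suc 0) = l - i \<and> R' 2 = n \<and> R' 3 = n + i \<and> R' 4 = 0 \<and> (\<forall>x \<ge> 6. R' x = R x))" for i s
  have "wp (While 1 erase_body) (R, M) (\<lambda>t s. t \<le> (l + 1) * (l + 1 + (10 + 5 * V)) \<and> Inv l s)"
  proof (rule wp_While)
    fix i s assume i: "i < l" and "Inv i s"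
    then obtain R' where s: "s = (R', \<lambda>j. if n \<le> j \<and> j < n + i then 0 else M j)" and
      R': "R' (Suc 0) = l - i" "R' 2 = n" "R' 3 = n + i" "R' 4 = 0" "\<forall>x \<ge> 6. R' x = R x"
      unfolding Inv_def by blast
    note step = wp_erase_step[where M = "\<lambda>j. if n \<le> j \<and> j < n + i then 0 else M j" and R = R', OF assms(1,2) i R'(1-4)]
    have upd: "(\<lambda>j. if n \<le> j \<and> j < n + i then 0 else M j)(n + i := 0)
        = (\<lambda>j. if n \<le> j \<and> j < n + Suc i then 0 else M j)"
      by (auto simp: fun_eq_iff less_Suc_eq)
    show "wp erase_body s (\<lambda>t s'. t \<le> 10 + 5 * V \<and> Inv (Suc i) s')"
      unfolding s by (rule wp_mono[OF step[unfolded upd]]) (use R'(5) in \<open>auto simp: Inv_def\<close>)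
  qed (use assms in \<open>auto simp: Inv_def\<close>)
  then show ?thesis by (rule wp_mono) (auto simp: Inv_def)
qed

section \<open>The reduction program for given output functions\<close>

context
  fixes len :: "nat list \<Rightarrow> nat" and out :: "nat list \<Rightarrow> nat \<Rightarrow> nat"
  assumes polytime_len: "polytime (\<lambda>xs. xs) {} len"
    and polytime_out: "polytime fst {snd} (\<lambda>p. out (fst p) (snd p))"
begin

lemma out_bound:
  "\<exists>T. poly_growth T \<and> (\<forall>xs V. fits xs V \<longrightarrow> len xs \<le> T V \<and> (\<forall>i \<le> len xs. out xs i \<le> T V))"
proof -
  obtain B where B: "poly_growth B" "\<And>xs V. fits xs V \<Longrightarrow> len xs \<le> B V"
    using polytime_bounded[OF polytime_len] by auto
  obtain B' where B': "poly_growth B'" "\<And>p V. fits (fst p) V \<Longrightarrow> snd p \<le> V \<Longrightarrow> out (fst p) (snd p) \<le> B' V"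
    using polytime_bounded[OF polytime_out] by auto
  have "out xs i \<le> B' (V + B V)" if "fits xs V" "i \<le> len xs" for xs V i
    using B'(2)[of "(xs, i)" "V + B V"] fits_mono[OF that(1), of "V + B V"] B(2)[OF that(1)] that(2) by simp
  then have "fits xs V \<longrightarrow> len xs \<le> B V + B' (V + B V) \<and> (\<forall>i \<le> len xs. out xs i \<le> B V + B' (V + B V))" for xs V
    using B(2)[of xs V] by (auto intro: trans_le_add1 trans_le_add2)
  moreover have "poly_growth (\<lambda>V. B V + B' (V + B V))"
    by (intro poly_growth_intros poly_growth_compose[OF B'(1)] B)
  ultimately show ?thesis by blast
qed

lemma wp_write_step:
  assumes "computes P D T fst {(3, snd)} 4 (\<lambda>p. out (fst p) (snd p))"
    "fits xs V" "i \<le> V" "len xs \<le> V" "out xs i \<le> V" "i < len xs"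
    "R 0 = length xs" "R 1 = len xs - i" "R 2 = len xs" "R 3 = i"
    "\<And>j. j < length xs \<Longrightarrow> M j = xs ! j"
  shows "wp (write_body P) (R, M)
    (\<lambda>t s. t \<le> T V + (10 + 7 * V) \<and> (\<exists>R'. s = (R', M(length xs + i := out xs i)) \<and>
       R' 0 = length xs \<and> R' 1 = len xs - Suc i \<and> R' 2 = len xs \<and> R' 3 = Suc i \<and>
       (\<forall>x \<ge> D + 6. R' x = R x)))"
  unfolding write_body_def wp_Seq[of P]
proof (rule wp_computes[OF assms(1), where a = "(xs, i)" and V = V])
  show "ready fst {(3, snd)} (xs, i) V (R, M)"
    using assms by (simp add: ready_def)
next
  fix t R1 assume 1: "t \<le> T V" "R1 4 = out (fst (xs, i)) (snd (xs, i))" "\<And>x. x < 4 \<or> D \<le> x \<Longrightarrow> R1 x = R x"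
  have b: "bits (length xs) \<le> V" "bits i \<le> V" "bits (out xs i) \<le> V" "bits (length xs + i) \<le> 2 * V" "bits (len xs - i) \<le> V" "bits (Suc 0) \<le> 1"
    using assms(2-5) bits_le[of "length xs"] bits_le[of i] bits_le[of "out xs i"] bits_le[of "length xs + i"]
      bits_le[of "len xs - i"] bits_le[of "Suc 0"] unfolding fits_def by linarith+
  have R1: "R1 0 = length xs" "R1 (Suc 0) = len xs - i" "R1 2 = len xs" "R1 3 = i" "R1 4 = out xs i"
    "\<And>x. D + 6 \<le> x \<Longrightarrow> R1 x = R x"
    using 1 assms by auto
  show "wp (Seq (Add 5 0 3) (Seq (Store 5 4) (Seq (Imm 5 1) (Seq (Add 3 3 5) (Sub 1 1 5))))) (R1, M)
    (\<lambda>t2 s. t + t2 \<le> T V + (10 + 7 * V) \<and> (\<exists>R'. s = (R', M(length xs + i := out xs i)) \<and>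
       R' 0 = length xs \<and> R' 1 = len xs - Suc i \<and> R' 2 = len xs \<and> R' 3 = Suc i \<and>
       (\<forall>x \<ge> D + 6. R' x = R x)))"
    using b R1 1(1) by (simp add: wp_basic)
qed

definition written :: "nat list \<Rightarrow> nat \<Rightarrow> nat \<Rightarrow> nat" where
  "written xs i j = (if j < length xs then xs ! j else if j < length xs + i then out xs (j - length xs) else 0)"

lemma wp_write_loop:
  assumes P: "computes P D T fst {(3, snd)} 4 (\<lambda>p. out (fst p) (snd p))"
    and V: "fits xs V" "len xs \<le> V" "\<And>i. i < len xs \<Longrightarrow> out xs i \<le> V"
    and R: "R 0 = length xs" "R 1 = len xs" "R 2 = len xs" "R 3 = 0"
  shows "wp (While 1 (write_body P)) (R, written xs 0) (\<lambda>t s. t \<le> (len xs + 1) * (len xs + 1 + (T V + (10 + 7 * V))) \<and>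
    (\<exists>R'. s = (R', written xs (len xs)) \<and> R' 0 = length xs \<and> R' 2 = len xs \<and> (\<forall>x \<ge> D + 6. R' x = R x)))"
proof -
  define Inv where "Inv i s \<longleftrightarrow> (\<exists>R'. s = (R', written xs i) \<and> R' 0 = length xs \<and> R' 1 = len xs - i \<and>
     R' 2 = len xs \<and> R' 3 = i \<and> (\<forall>x \<ge> D + 6. R' x = R x))" for i s
  have "wp (While 1 (write_body P)) (R, written xs 0)
    (\<lambda>t s. t \<le> (len xs + 1) * (len xs + 1 + (T V + (10 + 7 * V))) \<and> Inv (len xs) s)"
  proof (rule wp_While)
    fix i s assume i: "i < len xs" and "Inv i s"
    then obtain R' where s: "s = (R', written xs i)" and R': "R' 0 = length xs" "R' 1 = len xs - i"
      "R' 2 = len xs" "R' 3 = i" "\<forall>x \<ge> D + 6. R' x = R x" unfolding Inv_def by blast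
    have upd: "(written xs i)(length xs + i := out xs i) = written xs (Suc i)"
      by (auto simp: fun_eq_iff written_def less_Suc_eq)
    have "wp (write_body P) (R', written xs i) (\<lambda>t s. t \<le> T V + (10 + 7 * V) \<and>
       (\<exists>R''. s = (R'', (written xs i)(length xs + i := out xs i)) \<and>
       R'' 0 = length xs \<and> R'' 1 = len xs - Suc i \<and> R'' 2 = len xs \<and> R'' 3 = Suc i \<and>
       (\<forall>x \<ge> D + 6. R'' x = R' x)))"
      by (rule wp_write_step[OF P V(1) _ V(2) V(3)[OF i] i R'(1-4)]) (use i V in \<open>auto simp: written_def\<close>)
    then show "wp (write_body P) s (\<lambda>t s'. t \<le> T V + (10 + 7 * V) \<and> Inv (Suc i) s')"
      unfolding s upd by (rule wp_mono) (use R'(5) in \<open>auto simp: Inv_def\<close>)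
  qed (use R in \<open>auto simp: Inv_def\<close>)
  then show ?thesis by (rule wp_mono) (auto simp: Inv_def)
qed

theorem reduction_program:
  "\<exists>P T. poly_growth T \<and> (\<forall>xs V. fits xs V \<longrightarrow>
     wp P (init xs) (\<lambda>t s. t \<le> T V \<and> s = init (map (out xs) [0..<len xs])) \<and>
     input_size (map (out xs) [0..<len xs]) \<le> T V)"
proof -
  have "layout {} ({} :: (nat \<times> (nat list \<Rightarrow> nat)) set) 1" by (simp add: layout_def)
  from polytime_program[OF polytime_len this] obtain P1 D1 T1
    where P1: "poly_growth T1" "computes P1 D1 T1 (\<lambda>xs. xs) {} 1 len" by blast
  have "layout {snd} {(3, snd :: nat list \<times> nat \<Rightarrow> nat)} 4" by (simp add: layout_def)
  from polytime_program[OF polytime_out this] obtain P2 D2 T2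
    where P2: "poly_growth T2" "computes P2 D2 T2 fst {(3, snd)} 4 (\<lambda>p. out (fst p) (snd p))" by blast
  obtain B where B: "poly_growth B"
    "\<And>xs V. fits xs V \<Longrightarrow> len xs \<le> B V" "\<And>xs V i. fits xs V \<Longrightarrow> i \<le> len xs \<Longrightarrow> out xs i \<le> B V"
    using out_bound by blast
  \<comment> \<open>No register from \<open>D\<close> on is touched: \<open>D1\<close> and
    \<open>D2\<close> limit the two computing programs, and 6 covers the registers of the
    loops.\<close>
  define D where "D = D1 + D2 + 6"
  define pre1 where "pre1 = Seq (Imm 2 0) (Seq (Add 2 2 1) (Imm 3 0))"
  define pre2 where "pre2 = Seq (Imm 3 0) (Seq (Imm 5 0) (Add 1 2 5))"
  define pre3 where "pre3 = Seq (Imm 5 0) (Seq (Add 1 0 5) (Imm 4 0))"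
  define fin where "fin = Seq (Imm 5 0) (Seq (Add 0 2 5) (clear_regs D))"
  define P where "P = Seq P1 (Seq pre1 (Seq (While 1 (write_body P2)) (Seq pre2 (Seq (While 1 copy_body)
    (Seq pre3 (Seq (While 1 erase_body) fin))))))"
  \<comment> \<open>One bound for the input, the output length and every output entry.\<close>
  define W where "W = (\<lambda>V. V + B V)"
  define T where "T = (\<lambda>V. T1 V + (3 + W V) + (W V + 1) * (W V + 1 + (T2 (W V) + (10 + 7 * W V))) + (3 + W V) +
     (W V + 1) * (W V + 1 + (10 + 9 * W V)) + (3 + W V) + (W V + 1) * (W V + 1 + (10 + 5 * W V)) + (3 + W V + D) + W V * (1 + W V))"
  have W: "poly_growth W" unfolding W_def by (intro poly_growth_intros B)
  have "poly_growth T" unfolding T_def by (intro poly_growth_intros poly_growth_compose[OF P2(1)] P1 W)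
  moreover have "wp P (init xs) (\<lambda>t s. t \<le> T V \<and> s = init (map (out xs) [0..<len xs])) \<and>
     input_size (map (out xs) [0..<len xs]) \<le> T V" if fits: "fits xs V" for xs V
  proof
    let ?V = "W V" and ?l = "length xs" and ?n = "len xs"
    have V: "fits xs ?V" "?l \<le> ?V" "?n \<le> ?V" "\<And>i. i < ?n \<Longrightarrow> out xs i \<le> ?V"
      using fits_mono[OF fits] fits B(2)[OF fits] B(3)[OF fits] unfolding W_def fits_def by (auto intro: trans_le_add2)
    have wV: "written xs ?n j \<le> ?V" for j
      using V unfolding written_def fits_def by auto
    have b: "bits ?l \<le> ?V" "bits ?n \<le> ?V" using V bits_le[of ?l] bits_le[of ?n] by linarith+
    have m: "(?n + 1) * (?n + 1 + c) \<le> (?V + 1) * (?V + 1 + c)" "(?l + 1) * (?l + 1 + c) \<le> (?V + 1) * (?V + 1 + c)" for c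
      using V by (auto intro!: mult_le_mono simp del: mult_Suc mult_Suc_right)
    have init: "init xs = ((\<lambda>r. if r = 0 then ?l else 0), written xs 0)"
      unfolding init_def written_def by (auto simp: fun_eq_iff)
    have r: "ready (\<lambda>xs. xs) {} xs V ((\<lambda>r. if r = 0 then ?l else 0), written xs 0)"
      using fits by (auto simp: ready_def written_def)
    show "wp P (init xs) (\<lambda>t s. t \<le> T V \<and> s = init (map (out xs) [0..<len xs]))"
      unfolding P_def init wp_Seq[of P1]
    proof (rule wp_computes[OF P1(2) r], unfold wp_Seq[of pre1] wp_Seq[of "While _ _"] wp_Seq[of pre2] wp_Seq[of pre3])
      fix t1 R1
      assume 1: "t1 \<le> T1 V" "R1 1 = len xs" "\<And>x. x < 1 \<or> D1 \<le> x \<Longrightarrow> R1 x = (if x = 0 then ?l else 0)"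
      let ?R1 = "R1(2 := len xs, 3 := 0)"
      have pre1: "wp pre1 (R1, M) Q" if "\<And>t. t \<le> 3 + ?V \<Longrightarrow> Q t (?R1, M)" for M Q
        using 1(2) b that unfolding pre1_def by (simp add: wp_basic)
      have pre2: "wp pre2 (R, M) Q" if "R 2 = ?n" "\<And>t. t \<le> 3 + ?V \<Longrightarrow> Q t (R(3 := 0, 5 := 0, 1 := ?n), M)" for R M Q
        using b that unfolding pre2_def by (simp add: wp_basic)
      have pre3: "wp pre3 (R, M) Q" if "R 0 = ?l" "\<And>t. t \<le> 3 + ?V \<Longrightarrow> Q t (R(5 := 0, 1 := ?l, 4 := 0), M)" for R M Q
        using b that unfolding pre3_def by (simp add: wp_basic)
      have fin: "wp fin (R, M) Q" if "R 2 = ?n" "\<And>x. D < x \<Longrightarrow> R x = 0"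
        "\<And>t. t \<le> 3 + ?V + D \<Longrightarrow> Q t ((\<lambda>x. if x = 0 then ?n else 0), M)" for R M Q
        unfolding fin_def wp_Seq wp_Imm wp_Add
      proof (rule wp_mono[OF wp_clear_regs], elim conjE)
        fix t s assume "t \<le> D + 1" and s: "s = ((\<lambda>x. if 0 < x \<and> x \<le> max 1 D then 0 else (R(5 := 0, 0 := (R(5 := 0)) 2 + (R(5 := 0)) 5)) x), M)"
        have "s = ((\<lambda>x. if x = 0 then ?n else 0), M)"
          unfolding s using that(1,2) by (auto simp: fun_eq_iff D_def not_le)
        then show "Q (1 + bits 0 + (1 + bits ((R(5 := 0)) 2) + bits ((R(5 := 0)) 5) + t)) s"
          using that(1,3) \<open>t \<le> D + 1\<close> b by (simp add: bits_0)
      qed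
      show "wp pre1 (R1, written xs 0) (\<lambda>t2 s2. wp (While 1 (write_body P2)) s2 (\<lambda>t3 s3. wp pre2 s3 (\<lambda>t4 s4.
          wp (While 1 copy_body) s4 (\<lambda>t5 s5. wp pre3 s5 (\<lambda>t6 s6. wp (While 1 erase_body) s6 (\<lambda>t7 s7. wp fin s7 (\<lambda>t8 s8.
            t1 + (t2 + (t3 + (t4 + (t5 + (t6 + (t7 + t8)))))) \<le> T V \<and> s8 = init (map (out xs) [0..<len xs]))))))))"
      proof (rule pre1, rule wp_mono[OF wp_write_loop[OF P2(2) V(1,3,4)]], goal_cases)
        case (6 t2 t3 s3)
        then obtain R3 where 3: "s3 = (R3, written xs ?n)" "R3 0 = ?l" "R3 2 = ?n" "\<And>x. D < x \<Longrightarrow> R3 x = 0"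
          using 1 by (auto simp: D_def)
        show ?case unfolding 3(1)
        proof (rule pre2[of R3, OF 3(3)], rule wp_mono[OF wp_copy_loop[OF V(2,3) wV]], goal_cases)
          case (5 t4 t5 s5)
          then obtain R5 where 5: "s5 = (R5, \<lambda>j. if j < ?n then written xs ?n (?l + j) else written xs ?n j)"
            "R5 0 = ?l" "R5 2 = ?n" "R5 3 = ?n" "\<And>x. D < x \<Longrightarrow> R5 x = 0"
            using 3 by (auto simp: D_def)
          show ?case unfolding 5(1)
          proof (rule pre3[of R5, OF 5(2)], rule wp_mono[OF wp_erase_loop[OF V(2,3)]], goal_cases)
            case (5 t6 t7 s7)
            note times = \<open>t2 \<le> _\<close> \<open>t3 \<le> _ \<and> _\<close> \<open>t4 \<le> _\<close> \<open>t5 \<le> _ \<and> _\<close> \<open>t6 \<le> _\<close> \<open>t7 \<le> _ \<and> _\<close>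
            define M where "M = (\<lambda>j. if ?n \<le> j \<and> j < ?n + ?l then 0 else
              if j < ?n then written xs ?n (?l + j) else written xs ?n j)"
            from 5 obtain R7 where 7: "s7 = (R7, M)" "R7 2 = ?n" "\<And>x. D < x \<Longrightarrow> R7 x = 0"
              using \<open>\<And>x. D < x \<Longrightarrow> R5 x = 0\<close> by (auto simp: D_def M_def)
            have M: "init (map (out xs) [0..<?n]) = ((\<lambda>x. if x = 0 then ?n else 0), M)"
              unfolding init_def M_def written_def by (auto simp: fun_eq_iff)
            show ?case unfolding 7(1)
            proof (rule fin[of R7, OF 7(2,3)])
              fix t8 assume "t8 \<le> 3 + ?V + D"
              with times(1,3,5) 1(1) le_trans[OF conjunct1[OF times(2)] m(1)]
                le_trans[OF conjunct1[OF times(4)] m(1)] le_trans[OF conjunct1[OF times(6)] m(2)]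
              have "t1 + (t2 + (t3 + (t4 + (t5 + (t6 + (t7 + t8)))))) \<le> T V"
                unfolding T_def by linarith
              then show "t1 + (t2 + (t3 + (t4 + (t5 + (t6 + (t7 + t8)))))) \<le> T V \<and>
                  ((\<lambda>x. if x = 0 then ?n else 0), M) = init (map (out xs) [0..<?n])"
                unfolding M by blast
            qed
          qed (use 5 in auto)
        qed (use 3 in auto)
      qed (use 1 in auto)
    qed
    show "input_size (map (out xs) [0..<len xs]) \<le> T V"
    proof -
      have "input_size (map (out xs) [0..<len xs]) \<le> ?n * (1 + ?V)"
        by (rule order_trans[OF input_size_le[where B = ?V]]) (use V in auto)
      also have "\<dots> \<le> ?V * (1 + ?V)" using V by (intro mult_le_mono) auto
      finally show ?thesis unfolding T_def by linarith
    qed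
  qed
  ultimately show ?thesis by blast
qed

end

section \<open>Hitting sets and vertex covers\<close>

lemma card_blocks:
  fixes w :: nat
  assumes "0 < w" "X \<subseteq> {..<w * g}"
  shows "card X = (\<Sum>i<g. card {r. r < w \<and> w * i + r \<in> X})"
proof -
  have "bij_betw (\<lambda>(i, r). w * i + r) (SIGMA i:{..<g}. {r. r < w \<and> w * i + r \<in> X}) X"
    unfolding bij_betw_def
  proof
    show "inj_on (\<lambda>(i, r). w * i + r) (SIGMA i:{..<g}. {r. r < w \<and> w * i + r \<in> X})"
    proof (rule inj_onI, clarify)
      fix i r i' r' assume e: "w * i + r = w * i' + r'" and r: "r < w" "r' < w"
      have "(w * i + r) div w = i" "(w * i' + r') div w = i'" using r by simp_all
      with e show "i = i' \<and> r = r'" by simp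
    qed
    show "(\<lambda>(i, r). w * i + r) ` (SIGMA i:{..<g}. {r. r < w \<and> w * i + r \<in> X}) = X"
    proof (intro equalityI subsetI)
      fix x assume x: "x \<in> X"
      then have "x div w < g" using assms by (auto simp: less_mult_imp_div_less mult.commute)
      then have "(x div w, x mod w) \<in> (SIGMA i:{..<g}. {r. r < w \<and> w * i + r \<in> X})"
        using x assms by simp
      moreover have "x = (\<lambda>(i, r). w * i + r) (x div w, x mod w)" by simp
      ultimately show "x \<in> (\<lambda>(i, r). w * i + r) ` (SIGMA i:{..<g}. {r. r < w \<and> w * i + r \<in> X})"
        by blast
    qed auto
  qed
  from bij_betw_same_card[OF this] show ?thesis by (simp add: card_SigmaI)
qed

lemma card_of_blocks:
  fixes w :: nat
  assumes "0 < w" "\<And>i. i < g \<Longrightarrow> A i \<subseteq> {..<w}"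
  shows "card {x. x < w * g \<and> x mod w \<in> A (x div w)} = (\<Sum>i<g. card (A i))"
proof -
  have "{r. r < w \<and> w * i + r \<in> {x. x < w * g \<and> x mod w \<in> A (x div w)}} = A i" if "i < g" for i
  proof -
    have "w * i + r < w * g" if "r < w" for r
    proof -
      have "w * Suc i \<le> w * g" using \<open>i < g\<close> by (intro mult_le_mono2) simp
      then show ?thesis using that by simp
    qed
    then show ?thesis using assms(2)[OF that] by auto
  qed
  then show ?thesis using card_blocks[OF assms(1), of "{x. x < w * g \<and> x mod w \<in> A (x div w)}" g] by auto
qed

text \<open>
  Vertices below \<open>k\<close> are the elements, and vertex \<open>k * Suc j + b\<close> is slot \<open>b\<close> of the clique for the set \<open>F j\<close>.
  All cliques have \<open>k\<close> slots; a slot \<open>b \<notin> F j\<close> is made useless by joining it to every element.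
\<close>

definition slot_conn :: "nat \<Rightarrow> (nat \<Rightarrow> nat set) \<Rightarrow> nat \<Rightarrow> nat \<Rightarrow> bool" where
  "slot_conn k F x y \<longleftrightarrow> x < k \<and> k \<le> y \<and> (x = y mod k \<or> y mod k \<notin> F (y div k - 1))"

definition hit_adj :: "nat \<Rightarrow> (nat \<Rightarrow> nat set) \<Rightarrow> nat \<Rightarrow> nat \<Rightarrow> bool" where
  "hit_adj k F u v \<longleftrightarrow> (k \<le> u \<and> k \<le> v \<and> u div k = v div k \<and> u \<noteq> v) \<or> slot_conn k F u v \<or> slot_conn k F v u"

definition hit_edges :: "nat \<Rightarrow> nat \<Rightarrow> (nat \<Rightarrow> nat set) \<Rightarrow> nat set set" where
  "hit_edges k m F = {{u, v} | u v. u < k * Suc m \<and> v < k * Suc m \<and> hit_adj k F u v}"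

section \<open>The clique graph of a family of sets\<close>

lemma hit_adj_sym: "hit_adj k F u v \<longleftrightarrow> hit_adj k F v u"
  unfolding hit_adj_def by auto

lemma hit_adj_irrefl: "\<not> hit_adj k F u u"
  unfolding hit_adj_def slot_conn_def by auto

lemma hit_edges_iff:
  "u < k * Suc m \<Longrightarrow> v < k * Suc m \<Longrightarrow> {u, v} \<in> hit_edges k m F \<longleftrightarrow> hit_adj k F u v"
  unfolding hit_edges_def using hit_adj_sym by (auto simp: doubleton_eq_iff)

lemma hit_edges_simple: "simple_graph {0..<k * Suc m} (hit_edges k m F)"
  unfolding simple_graph_def
proof (intro conjI ballI)
  fix e assume "e \<in> hit_edges k m F"
  then obtain u v where "e = {u, v}" "u < k * Suc m" "v < k * Suc m" "hit_adj k F u v"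
    unfolding hit_edges_def by blast
  moreover then have "u \<noteq> v" using hit_adj_irrefl by metis
  ultimately show "e \<subseteq> {0..<k * Suc m}" "card e = 2" by auto
qed simp

text \<open>What remains is a disjoint union of cliques, the quotient by \<open>k\<close> naming the
  clique. A cycle stays in one clique, so its vertices at positions 0 and 2 are adjacent, and from
  length 4 on they form a chord.\<close>

lemma hit_edges_chordal: "chordal_deletion_set {0..<k * Suc m} (hit_edges k m F) {0..<k}"
  unfolding chordal_deletion_set_def
proof
  show "chordal ({0..<k * Suc m} - {0..<k}) {e \<in> hit_edges k m F. e \<inter> {0..<k} = {}}" (is "chordal ?V ?E")
    unfolding chordal_def
  proof (intro allI impI, elim conjE)
    fix vs assume cyc: "is_cycle ?V ?E vs" and len: "length vs \<ge> 4"
    have V: "k \<le> vs ! i" "vs ! i < k * Suc m" if "i < length vs" for i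
      using cyc that nth_mem[OF that] unfolding is_cycle_def by fastforce+
    have step: "vs ! i div k = vs ! Suc i div k" if "Suc i < length vs" for i
    proof -
      have "{vs ! i, vs ! (Suc i mod length vs)} \<in> ?E" using cyc that Suc_lessD unfolding is_cycle_def by blast
      then have "hit_adj k F (vs ! i) (vs ! Suc i)"
        using hit_edges_iff[OF V(2) V(2), of i "Suc i"] that by simp
      then show ?thesis using V[of i] V[of "Suc i"] that unfolding hit_adj_def slot_conn_def by auto
    qed
    have l: "0 < length vs" "2 < length vs" using len by linarith+
    have "vs ! 0 div k = vs ! 2 div k" using step[of 0] step[of 1] len by (simp add: numeral_2_eq_2)
    moreover have "vs ! 0 \<noteq> vs ! 2"
      using cyc len nth_eq_iff_index_eq[of vs 0 2] unfolding is_cycle_def by force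
    ultimately have "hit_adj k F (vs ! 0) (vs ! 2)" using V(1)[of 0] V(1)[of 2] l unfolding hit_adj_def by blast
    then have "{vs ! 0, vs ! 2} \<in> ?E"
      using hit_edges_iff[OF V(2) V(2), of 0 2] V(1)[of 0] V(1)[of 2] l by auto
    then show "has_chord ?E vs"
      unfolding has_chord_def using len by (intro exI[of _ 0] exI[of _ 2] conjI) (auto simp: mod_less)
  qed
qed auto

text \<open>Clique \<open>j\<close> omits the slot of some \<open>b j \<in> Y \<inter> F j\<close>.
  Because \<open>b j \<in> F j\<close>, this slot is joined to no element but \<open>b j\<close>,
  and that edge is covered from the other end. Layer 0 consists of the elements, layer
  \<open>Suc j\<close> of the clique for \<open>F j\<close>.\<close>

lemma vertex_cover_of_hitting_set:
  assumes k: "0 < k" and Y: "Y \<subseteq> {..<k}" and hit: "\<And>j. j < m \<Longrightarrow> Y \<inter> F j \<noteq> {}"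
  shows "\<exists>X. vertex_cover {0..<k * Suc m} (hit_edges k m F) X \<and> card X = card Y + m * (k - 1)"
proof -
  have "\<forall>j. \<exists>b. j < m \<longrightarrow> b \<in> Y \<inter> F j" using hit by blast
  then obtain b where b: "\<And>j. j < m \<Longrightarrow> b j \<in> Y" "\<And>j. j < m \<Longrightarrow> b j \<in> F j" by (metis IntE)
  define A where "A j = (if j = 0 then Y else {..<k} - {b (j - 1)})" for j
  define X where "X = {x. x < k * Suc m \<and> x mod k \<in> A (x div k)}"
  have "card X = (\<Sum>j<Suc m. card (A j))"
    unfolding X_def by (rule card_of_blocks[OF k]) (use Y in \<open>auto simp: A_def\<close>)
  also have "\<dots> = card Y + (\<Sum>j<m. card (A (Suc j)))"
    by (subst sum.lessThan_Suc_shift) (simp add: A_def)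
  also have "(\<Sum>j<m. card (A (Suc j))) = (\<Sum>j<m. k - 1)"
  proof (rule sum.cong)
    fix j assume "j \<in> {..<m}"
    then have "b j \<in> {..<k}" using b(1) Y by auto
    then show "card (A (Suc j)) = k - 1" unfolding A_def by simp
  qed simp
  finally have card: "card X = card Y + m * (k - 1)" by simp
  have conn: "u \<in> X \<or> v \<in> X" if uv: "u < k * Suc m" "v < k * Suc m" and c: "slot_conn k F u v" for u v
  proof (rule ccontr)
    assume no: "\<not> (u \<in> X \<or> v \<in> X)"
    from c have u: "u < k" "k \<le> v" "u = v mod k \<or> v mod k \<notin> F (v div k - 1)" unfolding slot_conn_def by auto
    have d: "0 < v div k" using u k by (simp add: div_greater_zero_iff)
    have "v div k < Suc m" using uv(2) by (simp add: less_mult_imp_div_less mult.commute)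
    then have j: "v div k - 1 < m" using d by linarith
    have "v mod k = b (v div k - 1)" using no uv(2) d k unfolding X_def A_def by auto
    then have "u \<in> Y" using b[OF j] u(3) by auto
    then have "u \<in> X" using uv u(1) unfolding X_def A_def by simp
    with no show False by simp
  qed
  have "vertex_cover {0..<k * Suc m} (hit_edges k m F) X"
    unfolding vertex_cover_def
  proof (intro conjI ballI)
    show "X \<subseteq> {0..<k * Suc m}" unfolding X_def by auto
    fix e assume "e \<in> hit_edges k m F"
    then obtain u v where e: "e = {u, v}" and uv: "u < k * Suc m" "v < k * Suc m" "hit_adj k F u v"
      unfolding hit_edges_def by blast
    have "u \<in> X \<or> v \<in> X"
    proof (cases "slot_conn k F u v \<or> slot_conn k F v u")
      case True
      then show ?thesis using conn uv by blast
    next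
      case False
      then have c: "k \<le> u" "k \<le> v" "u div k = v div k" "u \<noteq> v" using uv(3) unfolding hit_adj_def by auto
      have "u mod k \<noteq> v mod k" using c(3,4) by (metis mod_div_decomp)
      moreover have "0 < u div k" using c k by (simp add: div_greater_zero_iff)
      ultimately show ?thesis using uv c k unfolding X_def A_def by auto
    qed
    then show "e \<inter> X \<noteq> {}" using e by auto
  qed
  with card show ?thesis by blast
qed

text \<open>
  A clique contained in the cover costs one extra vertex, which pays for an element of \<open>F j\<close>. If \<open>F j\<close> is
  empty, the dummy element \<open>k\<close> is bought instead.
\<close>

lemma hitting_set_of_vertex_cover:
  assumes X: "vertex_cover {0..<k * Suc m} (hit_edges k m F) X" "card X = B + m * (k - 1)"
    and B: "B < k" and F: "\<And>j. j < m \<Longrightarrow> F j \<subseteq> {..<k}"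
  shows "\<exists>Y \<subseteq> {..k}. card Y \<le> B \<and> (\<forall>j<m. Y \<inter> (if F j = {} then {k} else F j) \<noteq> {})"
proof -
  have k: "0 < k" using B by simp
  have XN: "X \<subseteq> {..<k * Suc m}" using X(1) unfolding vertex_cover_def by auto
  have cover: "u \<in> X \<or> v \<in> X" if "u < k * Suc m" "v < k * Suc m" "hit_adj k F u v" for u v
    using X(1) hit_edges_iff[OF that(1,2), of F] that(3) unfolding vertex_cover_def by auto
  define C where "C j = {b. b < k \<and> k * j + b \<in> X}" for j
  define full where "full j \<longleftrightarrow> (\<forall>b<k. k * Suc j + b \<in> X)" for j
  have fin: "finite (C j)" for j unfolding C_def by simp
  have in_range: "k * Suc j + b < k * Suc m" if "j < m" "b < k" for j b
  proof -
    have "k * Suc (Suc j) \<le> k * Suc m" using that by (intro mult_le_mono2) simp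
    then show ?thesis using that by simp
  qed
  \<comment> \<open>Two slots outside the cover would span an uncovered edge, so a clique misses at
    most one.\<close>
  have clique: "card (C (Suc j)) \<ge> (k - 1) + of_bool (full j)" if j: "j < m" for j
  proof (cases "full j")
    case True
    then have "C (Suc j) = {..<k}" unfolding full_def C_def by auto
    then show ?thesis using True k by simp
  next
    case False
    then obtain b where b: "b < k" "k * Suc j + b \<notin> X" unfolding full_def by blast
    have "{..<k} - {b} \<subseteq> C (Suc j)"
    proof
      fix b' assume b': "b' \<in> {..<k} - {b}"
      have "hit_adj k F (k * Suc j + b) (k * Suc j + b')"
        unfolding hit_adj_def using b(1) b' by (simp del: mult_Suc_right) simp
      then have "k * Suc j + b' \<in> X" using cover[OF in_range[OF j] in_range[OF j]] b b' by blast
      then show "b' \<in> C (Suc j)" using b' unfolding C_def by simp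
    qed
    from card_mono[OF fin this] show ?thesis using b(1) False by simp
  qed
  have "B + m * (k - 1) = (\<Sum>j<Suc m. card (C j))"
    using card_blocks[OF k XN] X(2) unfolding C_def by simp
  also have "\<dots> = card (C 0) + (\<Sum>j<m. card (C (Suc j)))" by (rule sum.lessThan_Suc_shift)
  finally have total: "B + m * (k - 1) = card (C 0) + (\<Sum>j<m. card (C (Suc j)))" .
  have "m * (k - 1) + card {j. j < m \<and> full j} = (\<Sum>j<m. (k - 1) + of_bool (full j))"
    by (simp add: sum.distrib of_bool_def sum.If_cases Int_def)
  also have "\<dots> \<le> (\<Sum>j<m. card (C (Suc j)))"
    by (rule sum_mono) (use clique in auto)
  \<comment> \<open>After subtracting the compulsory \<open>k - 1\<close> vertices per clique, the
    elements in the cover and the full cliques share the budget \<open>B\<close>.\<close>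
  finally have count: "card (C 0) + card {j. j < m \<and> full j} \<le> B" using total by linarith
  define pick where "pick j = (SOME a. a \<in> (if F j = {} then {k} else F j))" for j
  have pick: "pick j \<in> (if F j = {} then {k} else F j)" for j
    unfolding pick_def by (rule someI_ex) auto
  define Y where "Y = C 0 \<union> pick ` {j. j < m \<and> full j}"
  have "Y \<subseteq> {..k}"
  proof -
    have "pick j \<le> k" if "j < m" for j
      using pick[of j] F[OF that] by (cases "F j = {}") auto
    then show ?thesis unfolding Y_def C_def by auto
  qed
  moreover have "card Y \<le> B"
  proof -
    have "card Y \<le> card (C 0) + card (pick ` {j. j < m \<and> full j})" unfolding Y_def by (rule card_Un_le)
    also have "card (pick ` {j. j < m \<and> full j}) \<le> card {j. j < m \<and> full j}" by (rule card_image_le) simp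
    finally show ?thesis using count by simp
  qed
  moreover have "Y \<inter> (if F j = {} then {k} else F j) \<noteq> {}" if j: "j < m" for j
  proof (cases "full j")
    case True
    then have "pick j \<in> Y" unfolding Y_def using j by simp
    then show ?thesis using pick[of j] by blast
  next
    case False
    then obtain b where b: "b < k" "k * Suc j + b \<notin> X" unfolding full_def by blast
    have nb: "a \<in> C 0" if "a < k" "a = b \<or> b \<notin> F j" for a
    proof -
      have "(k * Suc j + b) div k = Suc j" "(k * Suc j + b) mod k = b" using b(1) by (simp_all del: mult_Suc_right)
      then have "hit_adj k F a (k * Suc j + b)"
        unfolding hit_adj_def slot_conn_def using that by simp
      moreover have "a < k * Suc m" using that(1) by (simp add: trans_less_add1)
      ultimately have "a \<in> X" using cover[OF _ in_range[OF j b(1)]] b(2) by blast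
      then show ?thesis using that unfolding C_def by simp
    qed
    show ?thesis
    proof (cases "b \<in> F j")
      case True
      then show ?thesis using nb[of b] b(1) unfolding Y_def by auto
    next
      case False
      \<comment> \<open>Omitting a useless slot would force all \<open>k\<close> elements into the
        cover, against \<open>B < k\<close>.\<close>
      then have "{..<k} \<subseteq> C 0" using nb by auto
      from card_mono[OF fin this] show ?thesis using count B by simp
    qed
  qed
  ultimately show ?thesis by blast
qed

section \<open>From formulas to hitting sets\<close>

lemma is_qcnf_nth:
  assumes "is_qcnf q n F" "c \<in> set F"
  shows "length c \<le> q" "i < length c \<Longrightarrow> fst (c ! i) < n"
proof -
  have c: "length c \<le> q" "\<And>l. l \<in> set c \<Longrightarrow> fst l < n"
    using assms unfolding is_qcnf_def by (auto simp: case_prod_beta)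
  then show "length c \<le> q" "i < length c \<Longrightarrow> fst (c ! i) < n" by auto
qed

text \<open>
  A block of \<open>2 * h\<close> elements stands for \<open>p\<close> variables: its half-size subsets are decoded by \<open>dec\<close>. The index
  \<open>z < Z\<close> enumerates both the \<open>q\<close>-tuples of half-size subsets and the subsets of size \<open>Suc h\<close>.
\<close>

locale group_code =
  fixes p h q Z :: nat and tuple :: "nat \<Rightarrow> nat \<Rightarrow> nat set" and large :: "nat \<Rightarrow> nat set"
    and dec :: "nat set \<Rightarrow> nat set"
  assumes p: "0 < p" and h: "0 < h" and Z: "0 < Z"
    and tuple: "\<And>z i. z < Z \<Longrightarrow> i < q \<Longrightarrow> tuple z i \<subseteq> {..<2 * h} \<and> card (tuple z i) = h"
    and tuple_surj: "\<And>X. (\<And>i. i < q \<Longrightarrow> X i \<subseteq> {..<2 * h} \<and> card (X i) = h) \<Longrightarrow> \<exists>z<Z. \<forall>i<q. tuple z i = X i"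
    and large: "\<And>z. z < Z \<Longrightarrow> large z \<subseteq> {..<2 * h} \<and> card (large z) = Suc h"
    and large_surj: "\<And>X. X \<subseteq> {..<2 * h} \<Longrightarrow> card X = Suc h \<Longrightarrow> \<exists>z<Z. large z = X"
    and dec_surj: "\<And>A. A \<subseteq> {..<p} \<Longrightarrow> \<exists>X \<subseteq> {..<2 * h}. card X = h \<and> dec X = A"
begin

text \<open>The extra group takes in an incomplete last one and keeps the universe nonempty even for
  \<open>n = 0\<close>.\<close>

definition groups :: "nat \<Rightarrow> nat" where "groups n = n div p + 1"

definition elems :: "nat \<Rightarrow> nat" where "elems n = 2 * h * groups n"

text \<open>Component \<open>i\<close> of a tuple is a guess for the block of the
  \<open>i\<close>-th literal; the decoded set lists the true variables of that group by their
  remainders modulo \<open>p\<close>.\<close>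

definition falsified :: "nat \<Rightarrow> nat \<Rightarrow> literal \<Rightarrow> bool" where
  "falsified z i l \<longleftrightarrow> (fst l mod p \<in> dec (tuple z i)) \<noteq> snd l"

text \<open>
  For half-size \<open>Y\<close>-blocks, missing the second part of \<open>clause_set\<close> means that \<open>Y\<close> agrees with the tuple \<open>z\<close> on every block
  touched by the clause; if the tuple satisfies the clause, the set is everything and imposes nothing.
\<close>

definition clause_set :: "nat \<Rightarrow> literal list \<Rightarrow> nat \<Rightarrow> nat set" where
  "clause_set n c z = {a. a < elems n \<and>
     ((\<exists>i<length c. \<not> falsified z i (c ! i)) \<or>
      (\<exists>i<length c. fst (c ! i) div p = a div (2 * h) \<and> a mod (2 * h) \<notin> tuple z i))}"

text \<open>Hitting all \<open>balance_set\<close>s of a block forces at least \<open>h\<close> of its elements.\<close>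

definition balance_set :: "nat \<Rightarrow> nat \<Rightarrow> nat \<Rightarrow> nat set" where
  "balance_set n g z = {a. a < elems n \<and> a div (2 * h) = g \<and> a mod (2 * h) \<in> large z}"

text \<open>The sets are numbered in runs of length \<open>Z\<close>, first for blocks and then for
  clauses. Sharing the range of \<open>z\<close> lets one quotient and one remainder identify a
  set.\<close>

definition target :: "nat \<Rightarrow> cnf \<Rightarrow> nat \<Rightarrow> nat set" where
  "target n F j = (if j div Z < groups n then balance_set n (j div Z) (j mod Z)
     else clause_set n (F ! (j div Z - groups n)) (j mod Z))"

definition num_targets :: "nat \<Rightarrow> nat \<Rightarrow> nat" where
  "num_targets n m = (groups n + m) * Z"

section \<open>Satisfying assignments and hitting sets\<close>

lemma target_index: "b < groups n + m \<Longrightarrow> z < Z \<Longrightarrow> Z * b + z < num_targets n m"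
proof -
  assume "b < groups n + m" "z < Z"
  then have "Z * Suc b \<le> Z * (groups n + m)" "Z * b + z < Z * Suc b" by (auto simp del: mult_Suc_right) simp
  then show ?thesis unfolding num_targets_def by (simp add: mult.commute)
qed

lemma group_less: "v < n \<Longrightarrow> v div p < groups n"
  unfolding groups_def using div_le_mono[of v n p] by simp

lemma elem_less: "g < groups n \<Longrightarrow> r < 2 * h \<Longrightarrow> 2 * h * g + r < elems n"
proof -
  assume g: "g < groups n" and r: "r < 2 * h"
  have "2 * h * Suc g \<le> 2 * h * groups n" using g by (intro mult_le_mono2) simp
  then show ?thesis unfolding elems_def using r by simp
qed

text \<open>Each block gets a half-size set that decodes to the true variables of its group; being
  half-size, it meets every set of size \<open>Suc h\<close> by counting. If a tuple falsifies the
  clause, then at a literal that \<open>\<alpha>\<close> makes true its component decodes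
  differently from the chosen set. The two sets differ and have equal size, so the chosen one is not
  contained in the component.\<close>

lemma hitting_set_of_satisfiable:
  assumes F: "is_qcnf q n F" and sat: "satisfiable F"
  shows "\<exists>Y \<subseteq> {..<elems n}. card Y = h * groups n \<and> (\<forall>j<num_targets n (length F). Y \<inter> target n F j \<noteq> {})"
proof -
  from sat obtain \<alpha> where \<alpha>: "\<And>c. c \<in> set F \<Longrightarrow> \<exists>(v, b) \<in> set c. \<alpha> v = b"
    unfolding satisfiable_def by blast
  have "\<forall>g. \<exists>X. X \<subseteq> {..<2 * h} \<and> card X = h \<and> dec X = {r. r < p \<and> \<alpha> (p * g + r)}"
    using dec_surj[of "{r. r < p \<and> \<alpha> (p * g + r)}" for g] by (metis (no_types, lifting) lessThan_iff mem_Collect_eq subsetI)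
  then obtain H where H: "\<And>g. H g \<subseteq> {..<2 * h}" "\<And>g. card (H g) = h"
    "\<And>g. dec (H g) = {r. r < p \<and> \<alpha> (p * g + r)}" by metis
  define Y where "Y = {a. a < 2 * h * groups n \<and> a mod (2 * h) \<in> H (a div (2 * h))}"
  have Yk: "Y \<subseteq> {..<elems n}" unfolding Y_def elems_def by auto
  have card: "card Y = h * groups n"
    unfolding Y_def using card_of_blocks[of "2 * h" "groups n" H] H h by simp
  have inY: "2 * h * g + r \<in> Y" if "g < groups n" "r \<in> H g" for g r
  proof -
    have "r < 2 * h" using H(1)[of g] that(2) by auto
    then show ?thesis using elem_less[OF that(1)] that unfolding Y_def elems_def by simp
  qed
  have bal: "Y \<inter> balance_set n g z \<noteq> {}" if "g < groups n" "z < Z" for g z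
  proof -
    have "H g \<inter> large z \<noteq> {}"
    proof
      assume e: "H g \<inter> large z = {}"
      have fin: "finite (H g)" "finite (large z)" using H(1) large[OF that(2)] finite_subset by blast+
      have "card (H g \<union> large z) \<le> card {..<2 * h}"
        using H(1) large[OF that(2)] by (intro card_mono) auto
      then show False using card_Un_disjoint[OF fin e] H(2) large[OF that(2)] by simp
    qed
    then obtain r where r: "r \<in> H g" "r \<in> large z" by blast
    then have "r < 2 * h" using H(1)[of g] by auto
    then have "2 * h * g + r \<in> balance_set n g z"
      using r elem_less[OF that(1)] unfolding balance_set_def by simp
    then show ?thesis using inY[OF that(1) r(1)] by blast
  qed
  have cl: "Y \<inter> clause_set n c z \<noteq> {}" if c: "c \<in> set F" and z: "z < Z" for c z
  proof (cases "\<exists>i<length c. \<not> falsified z i (c ! i)")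
    case True
    have "Y \<noteq> {}" using card h by (auto simp: groups_def)
    then show ?thesis using True Yk unfolding clause_set_def by blast
  next
    case False
    from \<alpha>[OF c] obtain i where i: "i < length c" "\<alpha> (fst (c ! i)) = snd (c ! i)"
      by (auto simp: in_set_conv_nth split: prod.splits)
    let ?v = "fst (c ! i)" and ?g = "fst (c ! i) div p"
    have v: "?v < n" and iq: "i < q"
      using is_qcnf_nth[OF F c] i(1) by auto
    have "\<not> H ?g \<subseteq> tuple z i"
    proof
      assume "H ?g \<subseteq> tuple z i"
      moreover have "finite (tuple z i)" using tuple[OF z iq] finite_subset by blast
      ultimately have "H ?g = tuple z i"
        using card_subset_eq[of "tuple z i" "H ?g"] H(2) tuple[OF z iq] by simp
      then have "dec (tuple z i) = {r. r < p \<and> \<alpha> (p * ?g + r)}" using H(3)[of ?g] by simp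
      then have "?v mod p \<in> dec (tuple z i) \<longleftrightarrow> \<alpha> ?v" using p by simp
      then show False using False i unfolding falsified_def by auto
    qed
    then obtain r where r: "r \<in> H ?g" "r \<notin> tuple z i" by blast
    have r2: "r < 2 * h" using H(1)[of ?g] r by auto
    have "2 * h * ?g + r \<in> clause_set n c z"
      unfolding clause_set_def using elem_less[OF group_less[OF v] r2] r2 r(2) i(1)
      by (auto intro!: exI[of _ i])
    then show ?thesis using inY[OF group_less[OF v] r(1)] by blast
  qed
  have "Y \<inter> target n F j \<noteq> {}" if "j < num_targets n (length F)" for j
  proof (cases "j div Z < groups n")
    case True
    then show ?thesis using bal Z unfolding target_def by simp
  next
    case False
    have "j div Z < groups n + length F"
      using that unfolding num_targets_def by (simp add: less_mult_imp_div_less)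
    then have "F ! (j div Z - groups n) \<in> set F" using False by (intro nth_mem) simp
    then show ?thesis using False cl Z unfolding target_def by simp
  qed
  with Yk card show ?thesis by blast
qed

text \<open>Every block of \<open>Y\<close> has at least \<open>h\<close> elements, so the budget
  forces exactly \<open>h\<close> and excludes the dummy element. If the decoded assignment
  falsified a clause, the tuple made of the blocks of \<open>Y\<close> itself would give a clause
  set that \<open>Y\<close> misses.\<close>

lemma satisfiable_of_hitting_set:
  assumes F: "is_qcnf q n F" and Yk: "Y \<subseteq> {..elems n}" and card: "card Y \<le> h * groups n"
    and hit: "\<And>j. j < num_targets n (length F) \<Longrightarrow> Y \<inter> (if target n F j = {} then {elems n} else target n F j) \<noteq> {}"
  shows "satisfiable F"
proof -
  define H where "H g = {r. r < 2 * h \<and> 2 * h * g + r \<in> Y}" for g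
  have fin: "finite (H g)" for g unfolding H_def by simp
  have H2: "H g \<subseteq> {..<2 * h}" for g unfolding H_def by auto
  have lower: "h \<le> card (H g)" if g: "g < groups n" for g
  proof (rule ccontr)
    assume "\<not> h \<le> card (H g)"
    \<comment> \<open>A block with fewer than \<open>h\<close> elements leaves more than half of it
      free, enough for a whole large set that \<open>Y\<close> avoids.\<close>
    then have "Suc h \<le> card ({..<2 * h} - H g)" using H2[of g] fin[of g] by (simp add: card_Diff_subset)
    then obtain X where X: "X \<subseteq> {..<2 * h} - H g" "card X = Suc h" by (metis obtain_subset_with_card_n)
    then obtain z where z: "z < Z" "large z = X" using large_surj[of X] by blast
    have idx: "Z * g + z < num_targets n (length F)" using target_index[of g n "length F" z] g z by simp
    have tg: "target n F (Z * g + z) = balance_set n g z" using g z(1) unfolding target_def by simp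
    have *: "Y \<inter> (if balance_set n g z = {} then {elems n} else balance_set n g z) \<noteq> {}"
      using hit[OF idx] unfolding tg .
    obtain r where r: "r \<in> X" using X(2) by fastforce
    have "2 * h * g + r \<in> balance_set n g z"
      using r X(1) z(2) elem_less[OF g, of r] unfolding balance_set_def by auto
    with * obtain a where a: "a \<in> Y" "a \<in> balance_set n g z" by (auto split: if_splits)
    then have "a mod (2 * h) \<in> H g" using h unfolding balance_set_def H_def by auto
    then show False using a(2) X(1) z(2) unfolding balance_set_def by auto
  qed
  have finY: "finite Y" using Yk finite_subset by blast
  have sum: "card (Y \<inter> {..<elems n}) = (\<Sum>g<groups n. card (H g))"
    using card_blocks[of "2 * h" "Y \<inter> {..<elems n}" "groups n"] h elem_less
    unfolding H_def elems_def by (auto intro!: sum.cong arg_cong[where f = card])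
  have low: "h * groups n \<le> (\<Sum>g<groups n. card (H g))"
    using sum_mono[of "{..<groups n}" "\<lambda>_. h" "\<lambda>g. card (H g)"] lower by (simp add: mult.commute)
  have Hh: "card (H g) = h" if g: "g < groups n" for g
  proof (rule ccontr)
    assume "card (H g) \<noteq> h"
    then have "h < card (H g)" using lower[OF g] by simp
    then have "(\<Sum>g<groups n. h) < (\<Sum>g<groups n. card (H g))"
      using g lower by (intro sum_strict_mono_ex1) auto
    then show False using card card_mono[of Y "Y \<inter> {..<elems n}"] finY sum by (simp add: mult.commute)
  qed
  \<comment> \<open>The blocks already exhaust the budget, so the dummy element has no room.\<close>
  have notin: "elems n \<notin> Y"
  proof
    assume "elems n \<in> Y"
    then have "card (Y \<inter> {..<elems n}) < card Y" using finY by (intro psubset_card_mono) auto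
    then show False using card sum low by simp
  qed
  define \<alpha> where "\<alpha> v \<longleftrightarrow> v mod p \<in> dec (H (v div p))" for v
  have "\<exists>(v, b) \<in> set c. \<alpha> v = b" if c: "c \<in> set F" for c
  proof (rule ccontr)
    assume unsat: "\<not> (\<exists>(v, b) \<in> set c. \<alpha> v = b)"
    obtain m where m: "m < length F" "c = F ! m" using c by (metis in_set_conv_nth)
    have lc: "length c \<le> q" and vars: "\<And>i. i < length c \<Longrightarrow> fst (c ! i) < n"
      using is_qcnf_nth[OF F c] by auto
    \<comment> \<open>Clauses may be shorter than \<open>q\<close>; the remaining components are
      filled with \<open>H 0\<close>, which has the right size because there is always a group
      0.\<close>
    define X where "X i = (if i < length c then H (fst (c ! i) div p) else H 0)" for i
    have "X i \<subseteq> {..<2 * h} \<and> card (X i) = h" for i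
      unfolding X_def using H2 Hh group_less vars by (auto simp: groups_def)
    then obtain z where z: "z < Z" "\<And>i. i < q \<Longrightarrow> tuple z i = X i" using tuple_surj[of X] by blast
    then have tup: "tuple z i = H (fst (c ! i) div p)" if "i < length c" for i
      using that lc unfolding X_def by simp
    have fals: "falsified z i (c ! i)" if "i < length c" for i
      using unsat nth_mem[OF that] tup[OF that] unfolding falsified_def \<alpha>_def by (auto simp: case_prod_beta)
    have idx: "Z * (groups n + m) + z < num_targets n (length F)"
      using target_index[of "groups n + m" n "length F" z] m z by simp
    have tg: "target n F (Z * (groups n + m) + z) = clause_set n c z"
      using z(1) m unfolding target_def by simp
    have "Y \<inter> (if clause_set n c z = {} then {elems n} else clause_set n c z) \<noteq> {}"
      using hit[OF idx] unfolding tg .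
    with notin obtain a where a: "a \<in> Y" "a \<in> clause_set n c z" by (auto split: if_splits)
    then obtain i where i: "i < length c" "fst (c ! i) div p = a div (2 * h)" "a mod (2 * h) \<notin> tuple z i"
      using fals unfolding clause_set_def by blast
    have "a mod (2 * h) \<in> H (a div (2 * h))" unfolding H_def using a(1) h by simp
    then show False using i tup[OF i(1)] by simp
  qed
  then show ?thesis unfolding satisfiable_def by blast
qed

definition vertices :: "nat \<Rightarrow> nat \<Rightarrow> nat" where
  "vertices n m = elems n * Suc (num_targets n m)"

definition budget :: "nat \<Rightarrow> nat \<Rightarrow> nat" where
  "budget n m = h * groups n + num_targets n m * (elems n - 1)"

lemma satisfiable_iff_vertex_cover:
  assumes F: "is_qcnf q n F"
  shows "satisfiable F \<longleftrightarrow> (\<exists>X. vertex_cover {0..<vertices n (length F)}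
    (hit_edges (elems n) (num_targets n (length F)) (target n F)) X \<and> card X = budget n (length F))"
proof
  have pos: "0 < elems n" unfolding elems_def groups_def using h by simp
  show "\<exists>X. vertex_cover {0..<vertices n (length F)}
    (hit_edges (elems n) (num_targets n (length F)) (target n F)) X \<and> card X = budget n (length F)"
    if "satisfiable F"
  proof -
    from hitting_set_of_satisfiable[OF F that] obtain Y where "Y \<subseteq> {..<elems n}" "card Y = h * groups n"
      "\<And>j. j < num_targets n (length F) \<Longrightarrow> Y \<inter> target n F j \<noteq> {}" by blast
    from vertex_cover_of_hitting_set[OF pos this(1,3)] this(2) show ?thesis
      unfolding vertices_def budget_def by simp
  qed
  assume "\<exists>X. vertex_cover {0..<vertices n (length F)}
    (hit_edges (elems n) (num_targets n (length F)) (target n F)) X \<and> card X = budget n (length F)"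
  then obtain X where X: "vertex_cover {0..<elems n * Suc (num_targets n (length F))}
    (hit_edges (elems n) (num_targets n (length F)) (target n F)) X"
    "card X = h * groups n + num_targets n (length F) * (elems n - 1)"
    unfolding vertices_def budget_def by blast
  \<comment> \<open>The inequality must be strict: a budget below the number of elements is what
    keeps a cover from taking all of them.\<close>
  have "h * groups n < elems n" unfolding elems_def groups_def using h by simp
  moreover have "target n F j \<subseteq> {..<elems n}" for j
    unfolding target_def balance_set_def clause_set_def by auto
  ultimately show "satisfiable F"
    using hitting_set_of_vertex_cover[OF X] satisfiable_of_hitting_set[OF F] by blast
qed

end

section \<open>Computing the reduction\<close>

definition start :: "nat list \<Rightarrow> nat \<Rightarrow> nat" where
  "start xs c = rec_nat 2 (\<lambda>_ s. s + 1 + rd xs s) c"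

text \<open>The two header entries put the first clause at position 2; a clause takes one cell for
  its length and one per literal, so positions are found only by walking through the word.\<close>

lemma start_simps: "start xs 0 = 2" "start xs (Suc c) = start xs c + 1 + rd xs (start xs c)"
  unfolding start_def by simp_all

lemma polytime_start:
  assumes "polytime I G c" shows "polytime I G (\<lambda>a. start (I a) (c a))"
  unfolding start_def
proof (rule polytime_rec[OF assms polytime_const])
  show "polytime (\<lambda>p. I (fst (fst p))) (with_index (with_index G)) (\<lambda>p. snd p + 1 + rd (I (fst (fst p))) (snd p))"
    by (intro polytime_add polytime_const polytime_rd polytime_bound_var)
  show "poly_bounded (\<lambda>p. I (fst p)) (with_index G) (\<lambda>p. rec_nat 2 (\<lambda>_ s. s + 1 + rd (I (fst p)) s) (snd p))"
  proof (rule poly_boundedI[of "\<lambda>V. 2 + V * (1 + V)"])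
    fix p V assume V: "fits (I (fst p)) V" "\<forall>g \<in> with_index G. g p \<le> V"
    \<comment> \<open>The bound must hold on arbitrary words, so it uses only the bound on entries:
      each step advances by at most \<open>1 + V\<close>.\<close>
    have "start (I (fst p)) j \<le> 2 + j * (1 + V)" for j
    proof (induction j)
      case (Suc j)
      then show ?case using rd_le[OF V(1), of "start (I (fst p)) j"] by (simp add: start_simps)
    qed (simp add: start_simps)
    moreover have "snd p * (1 + V) \<le> V * (1 + V)" using V(2) by (intro mult_le_mono1) (simp add: with_index_def)
    ultimately show "rec_nat 2 (\<lambda>_ s. s + 1 + rd (I (fst p)) s) (snd p) \<le> 2 + V * (1 + V)"
      unfolding start_def by (meson add_left_mono le_trans)
  qed (intro poly_growth_intros)
qed

definition encode_clause :: "literal list \<Rightarrow> nat list" where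
  "encode_clause c = length c # map encode_literal c"

lemma encode_clause_simps [simp]:
  "length (encode_clause c) = Suc (length c)" "encode_clause c ! 0 = length c"
  "i < length c \<Longrightarrow> encode_clause c ! Suc i = encode_literal (c ! i)"
  by (simp_all add: encode_clause_def)

lemma rd_encode_clause:
  assumes "c < length F" "i < length (encode_clause (F ! c))"
  shows "rd (encode_cnf n F) (2 + length (concat (take c (map encode_clause F))) + i) = encode_clause (F ! c) ! i"
proof -
  let ?ys = "map encode_clause F"
  have "?ys = take c ?ys @ encode_clause (F ! c) # drop (Suc c) ?ys"
    using assms(1) id_take_nth_drop[of c ?ys] by simp
  then have "concat ?ys = concat (take c ?ys) @ encode_clause (F ! c) @ concat (drop (Suc c) ?ys)"
    by (metis concat.simps(2) concat_append)
  moreover have "encode_cnf n F = n # length F # concat ?ys"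
    unfolding encode_cnf_def encode_clause_def ..
  ultimately show ?thesis unfolding rd_def using assms(2) by (simp add: nth_append del: encode_clause_simps)
qed

lemma start_encode:
  assumes "c \<le> length F"
  shows "start (encode_cnf n F) c = 2 + length (concat (take c (map encode_clause F)))"
  using assms
proof (induction c)
  case (Suc c)
  have "rd (encode_cnf n F) (start (encode_cnf n F) c) = length (F ! c)"
    using rd_encode_clause[of c F 0 n] Suc by simp
  then show ?case using Suc by (simp add: start_simps take_Suc_conv_app_nth)
qed (simp add: start_simps)

lemma rd_encode:
  assumes "c < length F"
  shows "rd (encode_cnf n F) (start (encode_cnf n F) c) = length (F ! c)"
    "i < length (F ! c) \<Longrightarrow> rd (encode_cnf n F) (start (encode_cnf n F) c + 1 + i) = encode_literal (F ! c ! i)"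
  using rd_encode_clause[OF assms, of 0 n] rd_encode_clause[OF assms, of "Suc i" n]
    start_encode[OF less_imp_le[OF assms], of n]
  by simp_all

lemma rd_encode_01:
  "rd (encode_cnf n F) 0 = n" "rd (encode_cnf n F) 1 = length F" "rd (encode_cnf n F) (Suc 0) = length F"
  by (simp_all add: rd_def encode_cnf_def)

lemma encode_literal_div_mod: "encode_literal l div 2 = fst l" "encode_literal l mod 2 = of_bool (snd l)"
  by (cases l, simp)+

text \<open>Row-major order, which gives each matrix entry as a function of its position in the
  word.\<close>

lemma concat_matrix:
  "concat (map (\<lambda>u. map (f u) [0..<w]) [0..<r]) = map (\<lambda>i. f (i div w) (i mod w)) [0..<w * r]"
proof (induction r)
  case (Suc r)
  have "map (\<lambda>i. f (i div w) (i mod w)) [w * r..<w * r + w] = map (f r) [0..<w]"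
  proof (rule nth_equalityI)
    fix i assume "i < length (map (\<lambda>i. f (i div w) (i mod w)) [w * r..<w * r + w])"
    then show "map (\<lambda>i. f (i div w) (i mod w)) [w * r..<w * r + w] ! i = map (f r) [0..<w] ! i" by simp
  qed simp
  moreover have "[0..<w * Suc r] = [0..<w * r] @ [w * r..<w * r + w]"
    using upt_add_eq_append[of 0 "w * r" w] by (simp add: add.commute)
  ultimately show ?case using Suc by simp
qed simp

context group_code
begin

section \<open>The output word as a function of the position\<close>

definition lit :: "nat list \<Rightarrow> nat \<Rightarrow> nat \<Rightarrow> nat" where
  "lit xs c i = rd xs (start xs c + 1 + i)"

text \<open>The reductions modulo \<open>Suc q\<close> only serve to bound the arguments of the finite table \<open>tuple\<close>
  on words that do not encode a formula.\<close>

definition in_target :: "nat list \<Rightarrow> nat \<Rightarrow> nat \<Rightarrow> bool" where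
  "in_target xs j a \<longleftrightarrow>
     j div Z < groups (rd xs 0) \<and> a div (2 * h) = j div Z \<and> a mod (2 * h) \<in> large (j mod Z) \<or>
     \<not> j div Z < groups (rd xs 0) \<and>
      ((\<exists>i < rd xs (start xs (j div Z - groups (rd xs 0))).
          lit xs (j div Z - groups (rd xs 0)) i div 2 mod p \<in> dec (tuple (j mod Z) (i mod Suc q)) \<longleftrightarrow>
          lit xs (j div Z - groups (rd xs 0)) i mod 2 = 1) \<or>
       (\<exists>i < rd xs (start xs (j div Z - groups (rd xs 0))).
          lit xs (j div Z - groups (rd xs 0)) i div 2 div p = a div (2 * h) \<and>
          \<not> a mod (2 * h) \<in> tuple (j mod Z) (i mod Suc q)))"

lemma polytime_groups: "polytime I G u \<Longrightarrow> polytime I G (\<lambda>a. groups (u a))"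
  unfolding groups_def by (intro polytime_add polytime_div polytime_const)

lemma polytime_elems: "polytime I G u \<Longrightarrow> polytime I G (\<lambda>a. elems (u a))"
  unfolding elems_def by (intro polytime_mult polytime_groups polytime_const)

lemma polytime_num_targets: "polytime I G u \<Longrightarrow> polytime I G v \<Longrightarrow> polytime I G (\<lambda>a. num_targets (u a) (v a))"
  unfolding num_targets_def by (intro polytime_mult polytime_add polytime_groups polytime_const)

lemma polytime_vertices: "polytime I G u \<Longrightarrow> polytime I G v \<Longrightarrow> polytime I G (\<lambda>a. vertices (u a) (v a))"
  unfolding vertices_def Suc_eq_plus1 by (intro polytime_mult polytime_add polytime_elems polytime_num_targets polytime_const)

lemma polytime_budget: "polytime I G u \<Longrightarrow> polytime I G v \<Longrightarrow> polytime I G (\<lambda>a. budget (u a) (v a))"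
  unfolding budget_def by (intro polytime_mult polytime_add polytime_diff polytime_groups polytime_elems polytime_num_targets polytime_const)

lemma polytime_lit: "polytime I G c \<Longrightarrow> polytime I G i \<Longrightarrow> polytime I G (\<lambda>a. lit (I a) (c a) (i a))"
  unfolding lit_def by (intro polytime_rd polytime_add polytime_const polytime_start)

lemma polytime_large:
  assumes "polytime I G a" "polytime I G j" shows "polytime I G (\<lambda>x. of_bool (a x mod (2 * h) \<in> large (j x mod Z)))"
  using polytime_table3[OF assms polytime_const[of _ _ 0], where A = "2 * h" and B = Z and C = 1 and f = "\<lambda>x y w. of_bool (x \<in> large y)"] h Z
  by simp

lemma polytime_tuple:
  assumes "polytime I G a" "polytime I G j" "polytime I G i"
  shows "polytime I G (\<lambda>x. of_bool (a x mod (2 * h) \<in> tuple (j x mod Z) (i x mod Suc q)))"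
  using polytime_table3[OF assms, where A = "2 * h" and B = Z and C = "Suc q" and f = "\<lambda>x y w. of_bool (x \<in> tuple y w)"] h Z
  by simp

lemma polytime_dec:
  assumes "polytime I G a" "polytime I G j" "polytime I G i"
  shows "polytime I G (\<lambda>x. of_bool (a x mod p \<in> dec (tuple (j x mod Z) (i x mod Suc q))))"
  using polytime_table3[OF assms, where A = p and B = Z and C = "Suc q" and f = "\<lambda>x y w. of_bool (x \<in> dec (tuple y w))"] p Z
  by simp

lemma polytime_in_target:
  assumes j: "polytime I G j" and a: "polytime I G a"
  shows "polytime I G (\<lambda>x. of_bool (in_target (I x) (j x) (a x)))"
  unfolding in_target_def
  by (intro polytime_disj polytime_conj polytime_not polytime_less polytime_eq polytime_iff polytime_ex polytime_large polytime_tuple polytime_dec polytime_div[OF _ polytime_const]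
      polytime_mod[OF _ polytime_const] polytime_lit polytime_start polytime_rd polytime_diff polytime_groups polytime_const polytime_bound_var
      j a polytime_lift[OF j] polytime_lift[OF a])

text \<open>One function serves both problems, whose encodings differ only in the final
  \<open>N\<close> membership bits; the output length selects the problem.\<close>

definition out :: "nat list \<Rightarrow> nat \<Rightarrow> nat" where
  "out xs i = (let n = rd xs 0; m = rd xs 1; N = vertices n m in
     if i = 0 then N else if i = 1 then elems n else if i = 2 then budget n m
     else if i - 3 < N * N then of_bool (hit_adj (elems n) (\<lambda>j. {b. in_target xs j b}) ((i - 3) div N) ((i - 3) mod N))
     else of_bool (i - 3 - N * N < elems n))"

lemma polytime_out:
  assumes i: "polytime I G i" shows "polytime I G (\<lambda>a. out (I a) (i a))"
  unfolding out_def Let_def hit_adj_def slot_conn_def mem_Collect_eq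
  by (intro polytime_If polytime_disj polytime_conj polytime_not polytime_less polytime_le polytime_eq polytime_in_target polytime_div polytime_mod polytime_mult polytime_rd polytime_diff
      polytime_vertices polytime_elems polytime_budget polytime_const i)

definition len_CVD :: "nat list \<Rightarrow> nat" where
  "len_CVD xs = 3 + vertices (rd xs 0) (rd xs 1) * vertices (rd xs 0) (rd xs 1)"

definition len_given_CVD :: "nat list \<Rightarrow> nat" where
  "len_given_CVD xs = len_CVD xs + vertices (rd xs 0) (rd xs 1)"

lemma polytime_len_CVD: "polytime I G (\<lambda>a. len_CVD (I a))"
  unfolding len_CVD_def by (intro polytime_add polytime_mult polytime_vertices polytime_rd polytime_const)

lemma polytime_len_given_CVD: "polytime I G (\<lambda>a. len_given_CVD (I a))"
  unfolding len_given_CVD_def by (intro polytime_add polytime_len_CVD polytime_vertices polytime_rd polytime_const)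

lemma in_target_encode:
  assumes F: "is_qcnf q n F" and j: "j < num_targets n (length F)" and a: "a < elems n"
  shows "in_target (encode_cnf n F) j a \<longleftrightarrow> a \<in> target n F j"
proof (cases "j div Z < groups n")
  case True
  then show ?thesis unfolding in_target_def target_def balance_set_def rd_encode_01 using a by simp
next
  case False
  let ?c = "j div Z - groups n"
  have "j div Z < groups n + length F"
    using j unfolding num_targets_def by (simp add: less_mult_imp_div_less)
  then have c: "?c < length F" using False by simp
  have "i mod Suc q = i" if "i < length (F ! ?c)" for i
    using is_qcnf_nth(1)[OF F nth_mem[OF c]] that by simp
  moreover have "lit (encode_cnf n F) ?c i = encode_literal (F ! ?c ! i)" if "i < length (F ! ?c)" for i
    unfolding lit_def using rd_encode(2)[OF c that] .
  ultimately show ?thesis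
    unfolding in_target_def target_def clause_set_def rd_encode_01 rd_encode(1)[OF c] falsified_def
    using False a by (auto simp: encode_literal_div_mod cong: conj_cong)
qed

lemma hit_adj_encode:
  assumes F: "is_qcnf q n F" and uv: "u < vertices n (length F)" "v < vertices n (length F)"
  shows "hit_adj (elems n) (\<lambda>j. {b. in_target (encode_cnf n F) j b}) u v \<longleftrightarrow> hit_adj (elems n) (target n F) u v"
proof -
  have k: "0 < elems n" unfolding elems_def groups_def using h by simp
  have *: "in_target (encode_cnf n F) (y div elems n - 1) (y mod elems n) \<longleftrightarrow>
      y mod elems n \<in> target n F (y div elems n - 1)" if "y < vertices n (length F)" "elems n \<le> y" for y
  proof (rule in_target_encode[OF F])
    have "0 < y div elems n" using that k by (simp add: div_greater_zero_iff)
    moreover have "y div elems n < Suc (num_targets n (length F))"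
      using that unfolding vertices_def by (metis less_mult_imp_div_less mult.commute)
    ultimately show "y div elems n - 1 < num_targets n (length F)" by linarith
  qed (use k in simp)
  show ?thesis unfolding hit_adj_def slot_conn_def using *[OF uv(1)] *[OF uv(2)] by auto
qed

lemma out_0_2:
  "out (encode_cnf n F) 0 = vertices n (length F)" "out (encode_cnf n F) 1 = elems n"
  "out (encode_cnf n F) 2 = budget n (length F)"
  by (simp_all add: out_def Let_def rd_encode_01)

lemma map_out_adjacency:
  assumes F: "is_qcnf q n F"
  defines "N \<equiv> vertices n (length F)"
  shows "map (\<lambda>i. out (encode_cnf n F) (3 + i)) [0..<N * N] =
    adjacency_bits N (hit_edges (elems n) (num_targets n (length F)) (target n F))"
  unfolding adjacency_bits_def concat_matrix
proof (rule map_cong)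
  fix i assume "i \<in> set [0..<N * N]"
  then have i: "i < N * N" by simp
  then have "0 < N" by (cases N) auto
  then have uv: "i div N < N" "i mod N < N" using i by (simp_all add: less_mult_imp_div_less)
  have "{i div N, i mod N} \<in> hit_edges (elems n) (num_targets n (length F)) (target n F) \<longleftrightarrow>
      hit_adj (elems n) (target n F) (i div N) (i mod N)"
    using hit_edges_iff uv unfolding N_def vertices_def by blast
  then show "out (encode_cnf n F) (3 + i) =
      of_bool ({i div N, i mod N} \<in> hit_edges (elems n) (num_targets n (length F)) (target n F))"
    using hit_adj_encode[OF F uv[unfolded N_def]] i
    unfolding out_def Let_def rd_encode_01 N_def by simp
qed simp

lemma map_upt_3: "map f [0..<3 + m] = f 0 # f 1 # f 2 # map (\<lambda>i. f (3 + i)) [0..<m]" for f :: "nat \<Rightarrow> nat"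
proof -
  have "[0..<3 + m] = [0, 1, 2] @ [3..<3 + m]"
    using upt_add_eq_append[of 0 3 m] by (simp add: upt_rec numeral_3_eq_3 numeral_2_eq_2)
  moreover have "map f [3..<3 + m] = map (\<lambda>i. f (3 + i)) [0..<m]"
    by (rule nth_equalityI) auto
  ultimately show ?thesis by simp
qed

lemma map_out_CVD:
  assumes F: "is_qcnf q n F"
  defines "N \<equiv> vertices n (length F)"
  shows "map (out (encode_cnf n F)) [0..<len_CVD (encode_cnf n F)] =
    N # elems n # budget n (length F) # adjacency_bits N (hit_edges (elems n) (num_targets n (length F)) (target n F))"
  unfolding len_CVD_def map_upt_3 out_0_2 rd_encode_01 N_def map_out_adjacency[OF F] ..

lemma map_out_given_CVD:
  assumes F: "is_qcnf q n F"
  defines "N \<equiv> vertices n (length F)"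
  shows "map (out (encode_cnf n F)) [0..<len_given_CVD (encode_cnf n F)] =
    N # elems n # budget n (length F) # adjacency_bits N (hit_edges (elems n) (num_targets n (length F)) (target n F))
      @ membership_bits N {0..<elems n}"
proof -
  have "map (\<lambda>i. out (encode_cnf n F) (3 + i)) [N * N..<N * N + N] = membership_bits N {0..<elems n}"
    unfolding membership_bits_def by (rule nth_equalityI) (auto simp: out_def Let_def rd_encode_01 N_def)
  then have "map (\<lambda>i. out (encode_cnf n F) (3 + i)) [0..<N * N + N] =
      adjacency_bits N (hit_edges (elems n) (num_targets n (length F)) (target n F)) @ membership_bits N {0..<elems n}"
    using map_out_adjacency[OF F] upt_add_eq_append[of 0 "N * N" N] unfolding N_def by simp
  then show ?thesis
    unfolding len_given_CVD_def len_CVD_def add.assoc map_upt_3 out_0_2 rd_encode_01 N_def by simp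
qed

end

section \<open>The lower bound\<close>

lemma polynomial_le_exponential:
  fixes \<eta> :: real
  assumes "0 < \<eta>"
  shows "\<exists>A>0. \<forall>n::nat. real (2 * n + b) ^ K \<le> A * 2 powr (\<eta> * real n)"
proof -
  \<comment> \<open>Chosen so that \<open>(K + 1) * \<theta> * (2 * n)\<close> equals
    \<open>\<eta> * n * ln 2\<close>; the estimate itself is \<open>x \<le> exp x\<close> raised to
    the power \<open>K\<close>. The \<open>+ 1\<close> keeps the denominator positive for
    \<open>K = 0\<close>.\<close>
  define \<theta> where "\<theta> = \<eta> * ln 2 / (2 * (K + 1))"
  have \<theta>: "0 < \<theta>" unfolding \<theta>_def using assms by simp
  define A where "A = exp (\<eta> * ln 2 * b / 2) / \<theta> ^ K"
  have "real (2 * n + b) ^ K \<le> A * 2 powr (\<eta> * real n)" for n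
  proof -
    let ?y = "real (2 * n + b)"
    have "(\<theta> * ?y) ^ K \<le> exp (\<theta> * ?y) ^ K"
      using \<theta> exp_ge_add_one_self[of "\<theta> * ?y"] by (intro power_mono) (auto simp del: exp_ge_add_one_self)
    also have "\<dots> = exp (K * (\<theta> * ?y))" by (simp add: exp_of_nat_mult)
    also have "\<dots> \<le> exp ((K + 1) * (\<theta> * ?y))"
      unfolding exp_le_cancel_iff by (intro mult_right_mono) (use \<theta> in auto)
    also have "(K + 1) * (\<theta> * ?y) = \<eta> * ln 2 * b / 2 + \<eta> * real n * ln 2"
      unfolding \<theta>_def by (simp add: field_simps)
    finally have "\<theta> ^ K * ?y ^ K \<le> exp (\<eta> * ln 2 * b / 2) * 2 powr (\<eta> * real n)"
      by (simp add: power_mult_distrib exp_add powr_def)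
    then show ?thesis unfolding A_def using \<theta> by (simp add: field_simps)
  qed
  moreover have "0 < A" unfolding A_def using \<theta> by simp
  ultimately show ?thesis by blast
qed

lemma length_le_input_size: "length xs \<le> input_size xs"
  by (induction xs) (auto simp: input_size_def)

text \<open>Entries are written in binary, so \<open>n\<close> and the literal codes may be
  exponential in the input size and must appear in the bound. The number of clauses need not: each
  clause occupies at least one cell.\<close>

lemma fits_encode_cnf:
  assumes F: "is_qcnf q n F"
  shows "fits (encode_cnf n F) (2 * n + q + input_size (encode_cnf n F))"
  unfolding fits_def
proof (intro conjI ballI)
  let ?s = "input_size (encode_cnf n F)"
  show "length (encode_cnf n F) \<le> 2 * n + q + ?s" using length_le_input_size[of "encode_cnf n F"] by simp
  fix x assume "x \<in> set (encode_cnf n F)"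
  then consider "x = n" | "x = length F" | c where "c \<in> set F" "x = length c"
    | c l where "c \<in> set F" "l \<in> set c" "x = encode_literal l"
    unfolding encode_cnf_def by auto
  then show "x \<le> 2 * n + q + ?s"
  proof cases
    case 2
    have "length F \<le> length (concat (map (\<lambda>c. length c # map encode_literal c) F))"
      by (induction F) auto
    then have "length F \<le> length (encode_cnf n F)" unfolding encode_cnf_def by simp
    then show ?thesis using 2 length_le_input_size[of "encode_cnf n F"] by simp
  next
    case 3
    then show ?thesis using is_qcnf_nth(1)[OF F] by fastforce
  next
    case 4
    then have "fst l < n" using is_qcnf_nth(2)[OF F] by (metis in_set_conv_nth)
    then show ?thesis using 4 by (cases l) auto
  qed simp
qed

lemma exec_pos: "exec P s t s' \<Longrightarrow> 0 < t"
  by (induction rule: exec.induct) auto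

context group_code
begin

text \<open>The reduction followed by \<open>P\<close> decides satisfiability. The exponential part
  costs \<open>2 * h / p * log 2 \<beta>\<close> in the exponent per variable, and the strict gap
  below \<open>\<delta>\<close> pays for the polynomial in \<open>n\<close>.\<close>

lemma SAT_solvable:
  fixes \<beta> \<delta> C :: real
  assumes len: "polytime (\<lambda>xs. xs) {} len"
    and P: "\<And>n F. is_qcnf q n F \<Longrightarrow> \<exists>t s.
      exec P (init (map (out (encode_cnf n F)) [0..<len (encode_cnf n F)])) t s \<and>
      (accepting s \<longleftrightarrow> satisfiable F) \<and>
      real t \<le> C * \<beta> ^ elems n * real (input_size (map (out (encode_cnf n F)) [0..<len (encode_cnf n F)])) ^ c"
    and \<beta>: "1 \<le> \<beta>" and C: "0 < C" and rate: "real (2 * h) / real p * log 2 \<beta> < \<delta>"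
  shows "solvable_Ostar (SAT q) (\<lambda>n. 2 powr (\<delta> * real n))"
proof -
  have out: "polytime fst {snd} (\<lambda>p. out (fst p) (snd p))" by (rule polytime_out) (simp add: polytime_var)
  from reduction_program[OF len out] obtain P0 T where T: "poly_growth T"
    and P0: "\<And>xs V. fits xs V \<Longrightarrow> wp P0 (init xs) (\<lambda>t s. t \<le> T V \<and> s = init (map (out xs) [0..<len xs]))"
      "\<And>xs V. fits xs V \<Longrightarrow> input_size (map (out xs) [0..<len xs]) \<le> T V"
    by blast
  from T obtain K where K: "\<And>V. T V \<le> (V + 2) ^ K" unfolding poly_growth_def by blast
  \<comment> \<open>\<open>K\<close> accounts for running the reduction, \<open>K * c\<close> for
    the power \<open>c\<close> of the size of its output.\<close>
  define K' where "K' = K + K * c"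
  define \<eta> where "\<eta> = \<delta> - real (2 * h) / real p * log 2 \<beta>"
  obtain A where A: "0 < A" "\<And>n::nat. real (2 * n + (q + 3)) ^ K' \<le> A * 2 powr (\<eta> * real n)"
    using polynomial_le_exponential[of \<eta> "q + 3" K'] rate unfolding \<eta>_def by auto
  define C' where "C' = (1 + C) * \<beta> ^ (2 * h) * A"
  have C': "0 < C'" unfolding C'_def using C \<beta> A by simp
  have "\<exists>t s. exec (Seq P0 P) (init (encode_cnf n F)) t s \<and> (accepting s \<longleftrightarrow> satisfiable F) \<and>
      real t \<le> C' * 2 powr (\<delta> * real n) * real (input_size (encode_cnf n F)) ^ K'" if F: "is_qcnf q n F" for n F
  proof -
    let ?xs = "encode_cnf n F"
    let ?s = "input_size ?xs"
    let ?ys = "map (out ?xs) [0..<len ?xs]"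
    let ?V = "2 * n + q + ?s"
    obtain t0 where t0: "exec P0 (init ?xs) t0 (init ?ys)" "t0 \<le> T ?V"
      using P0(1)[OF fits_encode_cnf[OF F]] unfolding wp_def by blast
    obtain t1 s where t1: "exec P (init ?ys) t1 s" "accepting s \<longleftrightarrow> satisfiable F"
      "real t1 \<le> C * \<beta> ^ elems n * real (input_size ?ys) ^ c"
      using P[OF F] by blast
    have s1: "1 \<le> ?s" using length_le_input_size[of ?xs] by (simp add: encode_cnf_def)
    \<comment> \<open>A product rather than a sum, so that its power splits into a factor in
      \<open>n\<close>, absorbed by the exponential, and a factor polynomial in the input
      size.\<close>
    let ?W = "real (2 * n + (q + 3)) * real ?s"
    have W1: "1 \<le> ?W" using s1 mult_mono[of 1 "real (2 * n + (q + 3))" 1 "real ?s"] by simp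
    have "?V + 2 \<le> (2 * n + (q + 3)) * ?s"
    proof -
      have "2 * n + q + 2 \<le> (2 * n + q + 2) * ?s"
        using mult_le_mono2[OF s1, of "2 * n + q + 2"] by (simp only: mult_1_right)
      then show ?thesis by (simp add: algebra_simps)
    qed
    then have V2: "real (?V + 2) \<le> ?W" by (metis of_nat_le_iff of_nat_mult)
    have "real (T ?V) \<le> real (?V + 2) ^ K" using K[of ?V] by (metis of_nat_le_iff of_nat_power)
    also have "\<dots> \<le> ?W ^ K" using V2 by (intro power_mono) auto
    finally have TV: "real (T ?V) \<le> ?W ^ K" .
    have \<beta>1: "1 \<le> \<beta> ^ elems n" using \<beta> by simp
    have "real t0 \<le> ?W ^ K" using t0(2) TV by linarith
    also have "\<dots> \<le> ?W ^ K'" using W1 unfolding K'_def by (intro power_increasing) auto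
    also have "\<dots> \<le> \<beta> ^ elems n * ?W ^ K'" using \<beta>1 W1 by (simp add: mult_le_cancel_right1)
    finally have b0: "real t0 \<le> \<beta> ^ elems n * ?W ^ K'" .
    have "real (input_size ?ys) \<le> ?W ^ K" using P0(2)[OF fits_encode_cnf[OF F]] TV by linarith
    then have "real (input_size ?ys) ^ c \<le> (?W ^ K) ^ c" by (intro power_mono) auto
    also have "\<dots> \<le> ?W ^ K'" unfolding power_mult[symmetric] using W1 unfolding K'_def by (intro power_increasing) auto
    finally have "C * \<beta> ^ elems n * real (input_size ?ys) ^ c \<le> C * \<beta> ^ elems n * ?W ^ K'"
      using C \<beta> by (intro mult_left_mono) auto
    then have "real (t0 + t1) \<le> (1 + C) * \<beta> ^ elems n * ?W ^ K'"
      using b0 t1(3) by (simp add: algebra_simps)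
    also have "\<dots> = (1 + C) * \<beta> ^ elems n * real (2 * n + (q + 3)) ^ K' * real ?s ^ K'"
      by (simp only: power_mult_distrib mult.assoc)
    also have "\<dots> \<le> (1 + C) * (\<beta> ^ (2 * h) * 2 powr (real (2 * h) / real p * log 2 \<beta> * real n)) *
        (A * 2 powr (\<eta> * real n)) * real ?s ^ K'"
    proof (intro mult_right_mono mult_mono mult_left_mono A(2))
      \<comment> \<open>The additional group costs the constant factor
        \<open>\<beta> ^ (2 * h)\<close>; the full groups number at most
        \<open>n / p\<close>.\<close>
      have "\<beta> ^ elems n = \<beta> ^ (2 * h) * \<beta> ^ (2 * h * (n div p))"
        unfolding elems_def groups_def by (simp add: power_add[symmetric] algebra_simps)
      also have "\<beta> ^ (2 * h * (n div p)) = \<beta> powr (real (2 * h) * real (n div p))"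
        using \<beta> by (simp add: powr_realpow[symmetric])
      also have "\<dots> \<le> \<beta> powr (real (2 * h) * (real n / real p))"
      proof -
        have "real (n div p) * real p \<le> real n" by (metis div_times_less_eq_dividend of_nat_le_iff of_nat_mult)
        then have "real (n div p) \<le> real n / real p" using p by (simp add: field_simps)
        then show ?thesis using \<beta> by (intro powr_mono mult_left_mono) auto
      qed
      also have "\<dots> = 2 powr (real (2 * h) / real p * log 2 \<beta> * real n)"
        using \<beta> by (simp add: powr_def log_def field_simps)
      finally show "\<beta> ^ elems n \<le> \<beta> ^ (2 * h) * 2 powr (real (2 * h) / real p * log 2 \<beta> * real n)"
        using \<beta> by simp
    qed (use C \<beta> in auto)
    also have "\<dots> = C' * 2 powr (\<delta> * real n) * real ?s ^ K'"
    proof -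
      have "2 powr (real (2 * h) / real p * log 2 \<beta> * real n) * 2 powr (\<eta> * real n) = 2 powr (\<delta> * real n)"
        unfolding powr_add[symmetric] \<eta>_def by (simp add: algebra_simps)
      then show ?thesis unfolding C'_def by (metis (no_types, opaque_lifting) mult.assoc mult.commute mult.left_commute)
    qed
    finally show ?thesis using exec.Seq[OF t0(1) t1(1)] t1(2) by blast
  qed
  then show ?thesis unfolding solvable_Ostar_def SAT_def using C'
    by (intro exI[of _ "Seq P0 P"] exI[of _ C'] exI[of _ K']) auto
qed

text \<open>The base \<open>\<gamma>\<close> may be below 1, where replacing \<open>n div p\<close>
  by \<open>n / p\<close> would decrease the power; passing to \<open>\<beta> \<ge> 1\<close> avoids
  this.\<close>

lemma SAT_solvable_by_CVD:
  fixes \<gamma> \<beta> \<delta> :: real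
  assumes solv: "solvable_Ostar VC_by_CVD (\<lambda>k. \<gamma> ^ k) \<or> solvable_Ostar VC_by_given_CVD (\<lambda>k. \<gamma> ^ k)"
    and \<beta>: "0 \<le> \<gamma>" "\<gamma> \<le> \<beta>" "1 \<le> \<beta>" and rate: "real (2 * h) / real p * log 2 \<beta> < \<delta>"
  shows "solvable_Ostar (SAT q) (\<lambda>n. 2 powr (\<delta> * real n))"
proof -
  have le: "C * \<gamma> ^ k * x ^ c \<le> C * \<beta> ^ k * x ^ c" if "0 < C" "0 \<le> x" for C x :: real and k c
    using that \<beta> by (intro mult_right_mono mult_left_mono power_mono) auto
  from solv show ?thesis
  proof
    assume "solvable_Ostar VC_by_CVD (\<lambda>k. \<gamma> ^ k)"
    then obtain P C c where C: "0 < C" and P: "\<forall>x \<in> instances VC_by_CVD. \<exists>t s.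
        exec P (init (encode VC_by_CVD x)) t s \<and> (accepting s \<longleftrightarrow> yes_instance VC_by_CVD x) \<and>
        real t \<le> C * \<gamma> ^ param VC_by_CVD x * real (input_size (encode VC_by_CVD x)) ^ c"
      unfolding solvable_Ostar_def by blast
    show ?thesis
    proof (rule SAT_solvable[OF polytime_len_CVD _ \<beta>(3) C rate])
      fix n F assume F: "is_qcnf q n F"
      let ?E = "hit_edges (elems n) (num_targets n (length F)) (target n F)"
      let ?x = "(vertices n (length F), ?E, elems n, budget n (length F))"
      have "simple_graph {0..<vertices n (length F)} ?E"
        unfolding vertices_def by (rule hit_edges_simple)
      moreover have "chordal_deletion_set {0..<vertices n (length F)} ?E {0..<elems n}"
        unfolding vertices_def by (rule hit_edges_chordal)
      ultimately have inst: "?x \<in> instances VC_by_CVD"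
        unfolding VC_by_CVD_def by (auto intro!: exI[of _ "{0..<elems n}"])
      have enc: "encode VC_by_CVD ?x = map (out (encode_cnf n F)) [0..<len_CVD (encode_cnf n F)]"
        unfolding map_out_CVD[OF F] by (simp add: VC_by_CVD_def)
      have yes: "yes_instance VC_by_CVD ?x \<longleftrightarrow> satisfiable F" "param VC_by_CVD ?x = elems n"
        unfolding satisfiable_iff_vertex_cover[OF F] by (simp_all add: VC_by_CVD_def)
      from bspec[OF P inst, unfolded enc yes] obtain t s
        where "exec P (init (map (out (encode_cnf n F)) [0..<len_CVD (encode_cnf n F)])) t s"
          "accepting s \<longleftrightarrow> satisfiable F"
          "real t \<le> C * \<gamma> ^ elems n * real (input_size (map (out (encode_cnf n F)) [0..<len_CVD (encode_cnf n F)])) ^ c"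
        by blast
      moreover have "C * \<gamma> ^ elems n * real (input_size (map (out (encode_cnf n F)) [0..<len_CVD (encode_cnf n F)])) ^ c \<le>
          C * \<beta> ^ elems n * real (input_size (map (out (encode_cnf n F)) [0..<len_CVD (encode_cnf n F)])) ^ c"
        by (rule le[OF C]) simp
      ultimately show "\<exists>t s. exec P (init (map (out (encode_cnf n F)) [0..<len_CVD (encode_cnf n F)])) t s \<and>
          (accepting s \<longleftrightarrow> satisfiable F) \<and>
          real t \<le> C * \<beta> ^ elems n * real (input_size (map (out (encode_cnf n F)) [0..<len_CVD (encode_cnf n F)])) ^ c"
        by (meson order_trans)
    qed
  next
    assume "solvable_Ostar VC_by_given_CVD (\<lambda>k. \<gamma> ^ k)"
    then obtain P C c where C: "0 < C" and P: "\<forall>x \<in> instances VC_by_given_CVD. \<exists>t s.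
        exec P (init (encode VC_by_given_CVD x)) t s \<and> (accepting s \<longleftrightarrow> yes_instance VC_by_given_CVD x) \<and>
        real t \<le> C * \<gamma> ^ param VC_by_given_CVD x * real (input_size (encode VC_by_given_CVD x)) ^ c"
      unfolding solvable_Ostar_def by blast
    show ?thesis
    proof (rule SAT_solvable[OF polytime_len_given_CVD _ \<beta>(3) C rate])
      fix n F assume F: "is_qcnf q n F"
      let ?E = "hit_edges (elems n) (num_targets n (length F)) (target n F)"
      let ?x = "(vertices n (length F), ?E, {0..<elems n}, elems n, budget n (length F))"
      have "simple_graph {0..<vertices n (length F)} ?E"
        unfolding vertices_def by (rule hit_edges_simple)
      moreover have "chordal_deletion_set {0..<vertices n (length F)} ?E {0..<elems n}"
        unfolding vertices_def by (rule hit_edges_chordal)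
      ultimately have inst: "?x \<in> instances VC_by_given_CVD"
        unfolding VC_by_given_CVD_def by (auto intro!: exI[of _ "{0..<elems n}"])
      have enc: "encode VC_by_given_CVD ?x = map (out (encode_cnf n F)) [0..<len_given_CVD (encode_cnf n F)]"
        unfolding map_out_given_CVD[OF F] by (simp add: VC_by_given_CVD_def)
      have yes: "yes_instance VC_by_given_CVD ?x \<longleftrightarrow> satisfiable F" "param VC_by_given_CVD ?x = elems n"
        unfolding satisfiable_iff_vertex_cover[OF F] by (simp_all add: VC_by_given_CVD_def)
      from bspec[OF P inst, unfolded enc yes] obtain t s
        where "exec P (init (map (out (encode_cnf n F)) [0..<len_given_CVD (encode_cnf n F)])) t s"
          "accepting s \<longleftrightarrow> satisfiable F"
          "real t \<le> C * \<gamma> ^ elems n * real (input_size (map (out (encode_cnf n F)) [0..<len_given_CVD (encode_cnf n F)])) ^ c"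
        by blast
      moreover have "C * \<gamma> ^ elems n * real (input_size (map (out (encode_cnf n F)) [0..<len_given_CVD (encode_cnf n F)])) ^ c \<le>
          C * \<beta> ^ elems n * real (input_size (map (out (encode_cnf n F)) [0..<len_given_CVD (encode_cnf n F)])) ^ c"
        by (rule le[OF C]) simp
      ultimately show "\<exists>t s. exec P (init (map (out (encode_cnf n F)) [0..<len_given_CVD (encode_cnf n F)])) t s \<and>
          (accepting s \<longleftrightarrow> satisfiable F) \<and>
          real t \<le> C * \<beta> ^ elems n * real (input_size (map (out (encode_cnf n F)) [0..<len_given_CVD (encode_cnf n F)])) ^ c"
        by (meson order_trans)
    qed
  qed
qed

end

section \<open>Existence of a group code\<close>

lemma enumerate_finite:
  assumes "finite A" "A \<noteq> {}"
  shows "\<exists>e. (\<forall>z. e z \<in> A) \<and> (\<forall>Z \<ge> card A. \<forall>x \<in> A. \<exists>z<Z::nat. e z = x)"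
proof -
  obtain f where f: "bij_betw f {0..<card A} A" using ex_bij_betw_nat_finite[OF assms(1)] by blast
  have pos: "0 < card A" using assms by (simp add: card_gt_0_iff)
  \<comment> \<open>The enumeration wraps around, so every sufficiently long index range works; a
    single \<open>Z\<close> can then serve sets of different sizes.\<close>
  have "f (z mod card A) \<in> A" for z using f pos unfolding bij_betw_def by auto
  moreover have "\<exists>z<Z. f (z mod card A) = x" if Z: "card A \<le> Z" and x: "x \<in> A" for Z x
  proof -
    have "x \<in> f ` {0..<card A}" using f x unfolding bij_betw_def by simp
    then obtain z where "z < card A" "f z = x" by auto
    then show ?thesis using Z by (intro exI[of _ z]) auto
  qed
  ultimately show ?thesis by (intro exI[of _ "\<lambda>z. f (z mod card A)"]) simp
qed

text \<open>The bound \<open>4 ^ m / (2 * m)\<close> on the central binomial coefficient of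
  \<open>2 * m\<close>, taken at \<open>m = 2 ^ (J - 1)\<close>, is exactly
  \<open>2 ^ (2 ^ J - J)\<close>. This is the origin of both the block size and the group
  size.\<close>

lemma two_power_le_central_binomial:
  assumes "0 < J" shows "2 ^ (2 ^ J - J) \<le> (2 * 2 ^ (J - 1)) choose 2 ^ (J - 1)"
proof -
  have two: "2 * 2 ^ (J - 1) = (2 :: nat) ^ J" using assms by (cases J) auto
  have "J < 2 ^ J" by simp
  then have "(2 :: real) ^ (2 ^ J - J) = 2 ^ (2 ^ J) / 2 ^ J" by (simp add: power_diff)
  also have "\<dots> = 4 ^ (2 ^ (J - 1)) / (2 * real (2 ^ (J - 1)))"
  proof -
    have "(4 :: real) ^ (2 ^ (J - 1)) = 2 ^ (2 * 2 ^ (J - 1))" by (simp add: power_mult)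
    moreover have "2 * real (2 ^ (J - 1)) = 2 ^ J" using two by (metis of_nat_mult of_nat_numeral of_nat_power)
    ultimately show ?thesis using two by simp
  qed
  also have "\<dots> \<le> real ((2 * 2 ^ (J - 1)) choose 2 ^ (J - 1))" by (rule central_binomial_lower_bound) simp
  finally show ?thesis by (metis of_nat_le_iff of_nat_numeral of_nat_power)
qed

lemma group_code_exists:
  assumes J: "0 < J"
  shows "\<exists>Z tuple large dec. group_code (2 ^ J - J) (2 ^ (J - 1)) q Z tuple large dec"
proof -
  define p h :: nat where "p = 2 ^ J - J" and "h = 2 ^ (J - 1)"
  have h: "0 < h" and p: "0 < p" unfolding h_def p_def by simp_all
  define H where "H m = {X. X \<subseteq> {..<2 * h} \<and> card X = m}" for m
  have fin: "finite (H m)" for m unfolding H_def by simp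
  have cardH: "card (H m) = (2 * h) choose m" for m unfolding H_def using n_subsets[of "{..<2 * h}" m] by simp
  have ne: "H m \<noteq> {}" if "m \<le> 2 * h" for m
    using cardH[of m] that by (metis binomial_eq_0_iff card.empty not_le)
  have "finite (PiE {..<q} (\<lambda>_. H h))" "PiE {..<q} (\<lambda>_. H h) \<noteq> {}"
    using fin ne[of h] by (simp_all add: finite_PiE PiE_eq_empty_iff)
  from enumerate_finite[OF this] obtain e where "\<forall>z. e z \<in> PiE {..<q} (\<lambda>_. H h)"
    "\<forall>Z \<ge> card (PiE {..<q} (\<lambda>_. H h)). \<forall>x \<in> PiE {..<q} (\<lambda>_. H h). \<exists>z<Z. e z = x"
    by (elim exE conjE)
  note e = this[rule_format]
  have "Suc h \<le> 2 * h" using h by simp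
  from enumerate_finite[OF fin ne[OF this]] obtain l where "\<forall>z. l z \<in> H (Suc h)"
    "\<forall>Z \<ge> card (H (Suc h)). \<forall>x \<in> H (Suc h). \<exists>z<Z. l z = x"
    by (elim exE conjE)
  note l = this[rule_format]
  have "card (Pow {..<p}) \<le> card (H h)"
    using two_power_le_central_binomial[OF J] cardH[of h] unfolding h_def p_def by (simp add: card_Pow)
  then obtain f where f: "inj_on f (Pow {..<p})" "f ` Pow {..<p} \<subseteq> H h"
    using inj_on_iff_card_le[of "Pow {..<p}" "H h"] fin by auto
  \<comment> \<open>Large enough for both enumerations; \<open>Suc\<close> makes positivity
    immediate.\<close>
  define Z where "Z = Suc (card (PiE {..<q} (\<lambda>_. H h)) + card (H (Suc h)))"
  \<comment> \<open>The decoder inverts an injection. Its values on the other half-size sets are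
    arbitrary, which is harmless: the clause sets and the decoded assignment use the same decoder,
    and only surjectivity is required.\<close>
  have "group_code p h q Z e l (inv_into (Pow {..<p}) f)"
  proof
    show "e z i \<subseteq> {..<2 * h} \<and> card (e z i) = h" if "i < q" for z i
      using e(1)[of z] that unfolding H_def by (auto simp: PiE_iff)
    show "\<exists>z<Z. \<forall>i<q. e z i = X i" if "\<And>i. i < q \<Longrightarrow> X i \<subseteq> {..<2 * h} \<and> card (X i) = h" for X
    proof -
      have "restrict X {..<q} \<in> PiE {..<q} (\<lambda>_. H h)" using that unfolding H_def by auto
      from e(2)[OF _ this, of Z] obtain z where "z < Z" "e z = restrict X {..<q}" unfolding Z_def by auto
      then show ?thesis by (intro exI[of _ z]) auto
    qed
    show "l z \<subseteq> {..<2 * h} \<and> card (l z) = Suc h" for z using l(1)[of z] unfolding H_def by simp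
    show "\<exists>z<Z. l z = X" if "X \<subseteq> {..<2 * h}" "card X = Suc h" for X
      using l(2)[of Z X] that unfolding H_def Z_def by simp
    show "\<exists>X\<subseteq>{..<2 * h}. card X = h \<and> inv_into (Pow {..<p}) f X = A" if "A \<subseteq> {..<p}" for A
    proof (intro exI conjI)
      show "inv_into (Pow {..<p}) f (f A) = A" using f(1) that by simp
      show "f A \<subseteq> {..<2 * h}" "card (f A) = h" using f(2) that unfolding H_def by auto
    qed
  qed (use p h in \<open>simp_all add: Z_def\<close>)
  then show ?thesis unfolding p_def h_def by blast
qed

section \<open>Choice of the block size\<close>

lemma dense_group_size:
  fixes r :: real
  assumes "r < 1" "0 \<le> r"
  shows "\<exists>J>0. real (2 * 2 ^ (J - 1)) / real (2 ^ J - J) * r < 1"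
proof -
  obtain i where i: "2 / (1 - r) < 2 ^ i" using real_arch_pow[of 2 "2 / (1 - r)"] by auto
  \<comment> \<open>The goal amounts to \<open>J < (1 - r) * 2 ^ J\<close>. With an even exponent
    one half of it bounds \<open>J\<close> by \<open>2 * 2 ^ Suc i\<close>, and in the other half
    \<open>(1 - r) * 2 ^ i\<close> beats the factor 2.\<close>
  define J where "J = 2 * Suc i"
  have "real J \<le> 2 * 2 ^ Suc i"
    unfolding J_def using less_exp[of "Suc i"] by (metis less_imp_le mult_le_mono2 of_nat_le_iff of_nat_mult of_nat_numeral of_nat_power)
  also have "\<dots> < ((1 - r) * 2 ^ i) * 2 ^ Suc i"
    using i assms by (intro mult_strict_right_mono) (auto simp: field_simps)
  also have "\<dots> \<le> (1 - r) * 2 ^ J"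
  proof -
    have "J = Suc (i + Suc i)" unfolding J_def by simp
    then have "2 ^ J = (2 :: real) * (2 ^ i * 2 ^ Suc i)" by (simp only: power_Suc power_add)
    then have "(1 - r) * 2 ^ J = 2 * ((1 - r) * 2 ^ i * 2 ^ Suc i)" by (simp only: mult_ac)
    moreover have "0 \<le> (1 - r) * 2 ^ i * 2 ^ Suc i" using assms by simp
    ultimately show ?thesis by linarith
  qed
  finally have J: "r * 2 ^ J < 2 ^ J - real J" by (simp add: algebra_simps)
  have "J < 2 ^ J" by simp
  then have "real (2 ^ J - J) = 2 ^ J - real J" "0 < real (2 ^ J - J)" by (simp_all add: of_nat_diff)
  moreover have "real (2 * 2 ^ (J - 1)) = 2 ^ J" unfolding J_def by simp
  ultimately have "real (2 * 2 ^ (J - 1)) / real (2 ^ J - J) * r < 1" using J by (simp add: field_simps)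
  then show ?thesis unfolding J_def by (intro exI[of _ "2 * Suc i"]) simp
qed

text \<open>For \<open>\<epsilon> \<ge> 2\<close> the time bound is not positive at \<open>k = 1\<close>.\<close>

lemma not_solvable_nonpositive_base:
  fixes \<gamma> :: real
  assumes "\<gamma> \<le> 0" "x \<in> instances A" "param A x = 1"
  shows "\<not> solvable_Ostar A (\<lambda>k. \<gamma> ^ k)"
proof
  assume "solvable_Ostar A (\<lambda>k. \<gamma> ^ k)"
  then obtain P C c where C: "0 < C" and P: "\<forall>x \<in> instances A. \<exists>t s. exec P (init (encode A x)) t s \<and>
      (accepting s \<longleftrightarrow> yes_instance A x) \<and> real t \<le> C * \<gamma> ^ param A x * real (input_size (encode A x)) ^ c"
    unfolding solvable_Ostar_def by blast
  from bspec[OF P assms(2)] obtain t s where t: "exec P (init (encode A x)) t s"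
    "real t \<le> C * \<gamma> ^ param A x * real (input_size (encode A x)) ^ c" by blast
  have "C * \<gamma> * real (input_size (encode A x)) ^ c \<le> 0"
    using assms(1) C by (simp add: mult_nonneg_nonpos mult_nonpos_nonneg)
  then show False using t(2) exec_pos[OF t(1)] assms(3) by simp
qed

lemma single_vertex_instances:
  "(1, {}, 1, 0) \<in> instances VC_by_CVD" "(1, {}, {0}, 1, 0) \<in> instances VC_by_given_CVD"
proof -
  have "chordal_deletion_set {0..<1::nat} {} {0}"
    by (auto simp: chordal_deletion_set_def chordal_def is_cycle_def)
  then show "(1, {}, 1, 0) \<in> instances VC_by_CVD" "(1, {}, {0}, 1, 0) \<in> instances VC_by_given_CVD"
    unfolding VC_by_CVD_def VC_by_given_CVD_def by (auto simp: simple_graph_def intro!: exI[of _ "{0}"])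
qed

theorem theorem4p4:
  assumes "SETH"
  shows "\<forall>\<epsilon>::real. \<epsilon> > 0 \<longrightarrow>
           \<not> solvable_Ostar VC_by_CVD (\<lambda>k. (2 - \<epsilon>) ^ k) \<and>
           \<not> solvable_Ostar VC_by_given_CVD (\<lambda>k. (2 - \<epsilon>) ^ k)"
proof (intro allI impI)
  fix \<epsilon> :: real assume \<epsilon>: "0 < \<epsilon>"
  show "\<not> solvable_Ostar VC_by_CVD (\<lambda>k. (2 - \<epsilon>) ^ k) \<and> \<not> solvable_Ostar VC_by_given_CVD (\<lambda>k. (2 - \<epsilon>) ^ k)"
  proof (cases "2 - \<epsilon> \<le> 0")
    case True
    have "param VC_by_CVD (1, {}, 1, 0) = 1" "param VC_by_given_CVD (1, {}, {0}, 1, 0) = 1"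
      by (simp_all add: VC_by_CVD_def VC_by_given_CVD_def)
    with not_solvable_nonpositive_base[OF True single_vertex_instances(1)]
      not_solvable_nonpositive_base[OF True single_vertex_instances(2)]
    show ?thesis by blast
  next
    case False
    \<comment> \<open>For \<open>\<epsilon> > 1\<close> the base is below 1; raising it to 1 makes
      its logarithm nonnegative while staying below 2.\<close>
    define \<beta> where "\<beta> = max (2 - \<epsilon>) 1"
    have \<beta>: "1 \<le> \<beta>" "\<beta> < 2" "2 - \<epsilon> \<le> \<beta>" using \<epsilon> unfolding \<beta>_def by auto
    have "log 2 \<beta> < 1" "0 \<le> log 2 \<beta>" using \<beta> by simp_all
    from dense_group_size[OF this] obtain J where J: "0 < J"
      "real (2 * 2 ^ (J - 1)) / real (2 ^ J - J) * log 2 \<beta> < 1" by blast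
    \<comment> \<open>Strictly between the rate of the reduction and 1: the lower gap absorbs
      polynomial factors, the upper one makes SETH applicable. Only now does SETH provide
      \<open>q\<close>, so \<open>J\<close> cannot depend on it.\<close>
    then obtain \<delta> where \<delta>: "real (2 * 2 ^ (J - 1)) / real (2 ^ J - J) * log 2 \<beta> < \<delta>" "\<delta> < 1"
      using dense by blast
    from assms \<delta>(2) obtain q where q: "\<not> solvable_Ostar (SAT q) (\<lambda>n. 2 powr (\<delta> * real n))"
      unfolding SETH_def by blast
    from group_code_exists[OF J(1)] obtain Z tuple large dec
      where "group_code (2 ^ J - J) (2 ^ (J - 1)) q Z tuple large dec" by blast
    from group_code.SAT_solvable_by_CVD[OF this _ _ \<beta>(3,1) \<delta>(1)] q False show ?thesis by auto
  qed
qed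

end
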